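(* Consider the Stackelberg game and the two-loop algorithm described in the context. Suppose the following three groups of conditions hold. Lipschitz/smoothness conditions: for every $y\in Y$, $f(\cdot,y)$ is $L_x$-Lipschitz; for every $x\in X$, $f(x,\cdot)$ is $L_y$-Lipschitz and $\ell_y$-smooth; for every $x\in X$, $S(x)$ is a singleton, and $x\mapsto S(x)$ is $L_S$-Lipschitz; $\tilde f$ is twice continuously differentiable, $\tilde L$-Lipschitz and $\tilde\ell$-smooth. Stability of follower updates: there is $C>0$ such that for any $x,\hat x\in X$, the follower updates started from the same initialization satisfy $\|y^{(K)}(x)-y^{(K)}(\hat x)\|\le C\|x-\hat x\|$. Convergence of follower updates: at least one of the following two alternatives holds for every $x\in X$ and every initial point $y^{(0)}\in Y$ (and every number $K$ of steps): (polynomial rate) $\|y^{(K)}(x)-S(x)\|^2\le CK^{-\lambda}\|y^{(0)}-S(x)\|^2$ for positive scalars $\lambda,C$; (exponential rate) $\|y^{(K)}(x)-S(x)\|\le C\rho^K\|y^{(0)}-S(x)\|$ for a positive scalar $C$ and $\rho\in[0,1)$. Choose $\eta_t=\bar\eta\,(t+1)^{-1/2}d^{-1}$ and $\delta_t=\bar\delta\,(t+1)^{-1/4}d^{-1/2}$, where $\bar\eta,\bar\delta>0$ and $\bar\eta\le d/(2\tilde\ell)$. Then the iterates $(x_t)_{t\in[T]}$ of the algorithm satisfy $$\min_{t\in[T]}\mathbb{E}\big[\|\nabla\tilde f(x_t)\|^2\big]\le \tilde O\left(\frac{d}{\sqrt T}+\frac{\alpha}{1-\alpha}\,d^3\Big(1+\frac{1}{\sqrt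 T}\Big)\right),$$ where $\alpha=CK^{-\lambda}$ if the polynomial-rate alternative holds, or $\alpha=\rho^K$ if the exponential-rate alternative holds.
   Context: **Game.** Let $X=\mathbb{R}^d$, let $Y\subset\mathbb{R}^{d'}$ be convex and compact, and let $f:X\times Y\to\mathbb{R}$ and $G:X\times Y\to\mathbb{R}^{d'}$ be twice continuously differentiable. For $x\in X$ let $S(x)=\{y\in Y:\langle y'-y,G(x,y)\rangle\ge 0\ \forall y'\in Y\}$ be the solution set of the variational inequality. The Stackelberg game is $\min_{x\in X,y\in Y}f(x,y)$ subject to $y\in S(x)$. Under the assumption that $S(x)$ is a singleton for every $x\in X$, $S(x)$ is identified with its unique element, and the hyper-objective is $\tilde f(x)=f(x,S(x))$, so the problem is $\min_{x\in X}\tilde f(x)$. A function $h$ is $L$-Lipschitz if $\|h(x)-h(x')\|\le L\|x-x'\|$ for all $x,x'$, and $\ell$-smooth if $\|\nabla h(x)-\nabla h(x')\|\le\ell\|x-x'\|$ for all $x,x'$. **Follower updates.** For $x\in X$ and an initialization $y^{(0)}\in Y$, followers iterate $y^{(k+1)}(x)=H_k(y^{(k)}(x);x)$, $k=0,\dots,K-1$, where $H_k$ is the given update map of an iterative solver and $K$ is a positive integer. **Algorithm.** Input: horizon $T$, $K$, initial $x_0\in X$, $y_0^{(0)},\tilde y_0^{(0)}\in Y$, step sizes $(\eta_t)$, perturbation radii $(\delta_t)$. For $t=0,1,\dots,T-1$: sample $v_t$ uniformly (independently of the past) from the unit sphere $\{z\in\mathbb{R}^d:\|z\|_2=1\}$;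 set $\hat x_t=x_t+\delta_tv_t$; for $k=0,\dots,K-1$ set $\tilde y_t^{(k+1)}=H_k(\tilde y_t^{(k)};x_t)$ and $y_t^{(k+1)}=H_k(y_t^{(k)};\hat x_t)$; set $x_{t+1}=x_t-\eta_t\frac{d}{\delta_t}\big(f(\hat x_t,y_t^{(K)})-f(x_t,\tilde y_t^{(K)})\big)v_t$; set $y_{t+1}^{(0)}=\tilde y_{t+1}^{(0)}=\tilde y_t^{(K)}$. **Notation.** $[T]=\{0,1,\dots,T\}$. $\tilde O(\cdot)$ hides factors logarithmic in $T$ and constants not depending on $T$, $d$, $K$.
   Formalization: Adds that the hyper-objective is bounded below (a bound on the initial gap, which enters the constant; the claim fails for linear f), that α<1 (otherwise the bound is undefined or negative), and that the update maps H_k are Borel measurable with values in Y. *)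

theory Defs
  imports "HOL-Probability.Probability"
begin

text \<open>
  The constants hidden in the rate must not depend on \<open>d\<close>, so they are quantified outside \<open>d\<close>, and
  \<open>d\<close> has to range over the natural numbers inside the formula; a type such as \<^typ>\<open>real ^ 'n\<close>
  does not allow this.  We therefore take \<open>\<real>\<^sup>d\<close> to be the \<open>d\<close>-dimensional subspace of the
  real inner product space of finitely supported sequences in which all coordinates from the index
  \<open>d\<close> on vanish.  Norm, inner product, derivatives (within the subspace), Lipschitz continuity and
  the Borel sets are the generic ones of the library.
  (The instance for \<open>poly_mapping\<close> in \<open>HOL-Analysis.Finite_Function_Topology\<close> carries the
  \<open>l\<^sub>1\<close> norm and is no inner product space.)
\<close>

typedef rseq = "{x :: nat \<Rightarrow> real. finite {i. x i \<noteq> 0}}"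
  morphisms coord Abs_rseq
  by (rule exI[of _ "\<lambda>_. 0"]) simp

setup_lifting type_definition_rseq

lemma rseq_eqI: "(\<And>i. coord x i = coord y i) \<Longrightarrow> x = y"
  by (simp add: coord_inject[symmetric] ext)

lemma finite_coord [simp]: "finite {i. coord x i \<noteq> 0}"
  using coord[of x] by simp

instantiation rseq :: real_vector
begin

lift_definition zero_rseq :: rseq is "\<lambda>_. 0" by simp

lift_definition plus_rseq :: "rseq \<Rightarrow> rseq \<Rightarrow> rseq" is "\<lambda>x y i. x i + y i"
proof -
  fix x y :: "nat \<Rightarrow> real"
  assume "finite {i. x i \<noteq> 0}" "finite {i. y i \<noteq> 0}"
  then have "finite ({i. x i \<noteq> 0} \<union> {i. y i \<noteq> 0})" by simp
  then show "finite {i. x i + y i \<noteq> 0}" by (rule rev_finite_subset) auto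
qed

lift_definition uminus_rseq :: "rseq \<Rightarrow> rseq" is "\<lambda>x i. - x i" by simp

definition minus_rseq :: "rseq \<Rightarrow> rseq \<Rightarrow> rseq" where
  "minus_rseq x y = x + (- y)"

lift_definition scaleR_rseq :: "real \<Rightarrow> rseq \<Rightarrow> rseq" is "\<lambda>r x i. r * x i"
  by (rule rev_finite_subset) auto

instance
  by standard
    (auto intro!: rseq_eqI simp: plus_rseq.rep_eq zero_rseq.rep_eq uminus_rseq.rep_eq
      minus_rseq_def scaleR_rseq.rep_eq algebra_simps)

end

instantiation rseq :: real_inner
begin

definition inner_rseq :: "rseq \<Rightarrow> rseq \<Rightarrow> real" where
  "inner_rseq x y = (\<Sum>i | coord x i \<noteq> 0. coord x i * coord y i)"

definition norm_rseq :: "rseq \<Rightarrow> real" where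
  "norm_rseq x = sqrt (inner x x)"

definition sgn_rseq :: "rseq \<Rightarrow> rseq" where
  "sgn_rseq x = x /\<^sub>R norm x"

definition dist_rseq :: "rseq \<Rightarrow> rseq \<Rightarrow> real" where
  "dist_rseq x y = norm (x - y)"

definition uniformity_rseq :: "(rseq \<times> rseq) filter" where
  "uniformity_rseq = (INF e\<in>{0<..}. principal {(x, y). dist x y < e})"

definition open_rseq :: "rseq set \<Rightarrow> bool" where
  "open_rseq U \<longleftrightarrow> (\<forall>x\<in>U. \<forall>\<^sub>F (x', y) in uniformity. x' = x \<longrightarrow> y \<in> U)"

lemma inner_rseq_superset:
  assumes "finite I" "{i. coord x i \<noteq> 0} \<subseteq> I"
  shows "inner x y = (\<Sum>i\<in>I. coord x i * coord y i)"
  unfolding inner_rseq_def by (rule sum.mono_neutral_left) (use assms in auto)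

instance
proof
  fix x y z :: rseq and r :: real
  let ?I = "{i. coord x i \<noteq> 0} \<union> {i. coord y i \<noteq> 0}"
  have I: "finite ?I" by simp
  have "inner x y = (\<Sum>i\<in>?I. coord x i * coord y i)"
    by (rule inner_rseq_superset) auto
  moreover have "inner y x = (\<Sum>i\<in>?I. coord y i * coord x i)"
    by (rule inner_rseq_superset) auto
  ultimately show "inner x y = inner y x"
    by (simp add: mult.commute)
  have "inner (x + y) z = (\<Sum>i\<in>?I. coord (x + y) i * coord z i)"
    by (rule inner_rseq_superset) (auto simp: plus_rseq.rep_eq)
  moreover have "inner x z = (\<Sum>i\<in>?I. coord x i * coord z i)"
    by (rule inner_rseq_superset) auto
  moreover have "inner y z = (\<Sum>i\<in>?I. coord y i * coord z i)"
    by (rule inner_rseq_superset) auto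
  ultimately show "inner (x + y) z = inner x z + inner y z"
    by (simp add: plus_rseq.rep_eq sum.distrib algebra_simps)
  have "inner (r *\<^sub>R x) y = (\<Sum>i | coord x i \<noteq> 0. coord (r *\<^sub>R x) i * coord y i)"
    by (rule inner_rseq_superset) (auto simp: scaleR_rseq.rep_eq)
  then show "inner (r *\<^sub>R x) y = r * inner x y"
    by (simp add: inner_rseq_def scaleR_rseq.rep_eq sum_distrib_left mult.assoc)
  show "0 \<le> inner x x"
    by (simp add: inner_rseq_def sum_nonneg)
  show "inner x x = 0 \<longleftrightarrow> x = 0"
  proof
    assume "inner x x = 0"
    then have "\<forall>i\<in>{i. coord x i \<noteq> 0}. coord x i * coord x i = 0"
      unfolding inner_rseq_def by (subst (asm) sum_nonneg_eq_0_iff) auto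
    then have "coord x i = 0" for i by auto
    then show "x = 0" by (intro rseq_eqI) (simp add: zero_rseq.rep_eq)
  qed (simp add: inner_rseq_def zero_rseq.rep_eq)
  show "sgn x = x /\<^sub>R norm x" by (rule sgn_rseq_def)
  show "dist x y = norm (x - y)" by (rule dist_rseq_def)
  show "norm x = sqrt (inner x x)" by (rule norm_rseq_def)
qed (rule uniformity_rseq_def open_rseq_def)+

end

definition Rd :: "nat \<Rightarrow> rseq set" where
  "Rd d = {x. \<forall>i\<ge>d. coord x i = 0}"

definition of_coords :: "nat \<Rightarrow> (nat \<Rightarrow> real) \<Rightarrow> rseq" where
  "of_coords d u = Abs_rseq (\<lambda>i. if i < d then u i else 0)"

text \<open>
  The uniform distribution on the unit sphere of \<open>\<real>\<^sup>d\<close>: the radial projection to the sphere of a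
  uniformly distributed point of the unit ball.  The final \<^const>\<open>restrict_space\<close> only removes a
  null set (the projection sends the origin to itself), so that the space of the measure is exactly
  the sphere.
\<close>

definition unif_sphere :: "nat \<Rightarrow> rseq measure" where
  "unif_sphere d =
     restrict_space
       (distr
          (uniform_measure (\<Pi>\<^sub>M i\<in>{..<d}. lborel)
             {u \<in> {..<d} \<rightarrow>\<^sub>E UNIV. norm (of_coords d u) \<le> 1})
          borel (\<lambda>u. sgn (of_coords d u)))
       {v \<in> Rd d. norm v = 1}"

definition gradient_within :: "'a::real_inner set \<Rightarrow> ('a \<Rightarrow> real) \<Rightarrow> 'a \<Rightarrow> 'a \<Rightarrow> bool" where
  "gradient_within S h x g \<longleftrightarrow> (h has_derivative (\<lambda>u. inner g u)) (at x within S)"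

text \<open>
  The gradient of a function on \<open>\<real>\<^sup>d\<close>; it is unique only among the vectors of \<open>\<real>\<^sup>d\<close>, since the
  derivative is taken within this subspace.
\<close>

definition grad :: "nat \<Rightarrow> (rseq \<Rightarrow> real) \<Rightarrow> rseq \<Rightarrow> rseq" where
  "grad d h x = (THE g. g \<in> Rd d \<and> gradient_within (Rd d) h x g)"

text \<open>
  Existence of a gradient field that is \<open>l\<close>-Lipschitz.  If \<open>S\<close> is convex with nonempty interior, the
  field is unique; otherwise it is determined along the directions of \<open>S\<close> only.
\<close>

definition smooth_on_set :: "real \<Rightarrow> 'a::real_inner set \<Rightarrow> ('a \<Rightarrow> real) \<Rightarrow> bool" where
  "smooth_on_set l S h \<longleftrightarrow>
     (\<exists>g. (\<forall>x\<in>S. gradient_within S h x (g x)) \<and> l-lipschitz_on S g)"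

definition C2_on :: "'a::real_normed_vector set \<Rightarrow> ('a \<Rightarrow> 'b::real_normed_vector) \<Rightarrow> bool" where
  "C2_on S h \<longleftrightarrow>
     (\<exists>(h' :: 'a \<Rightarrow> 'a \<Rightarrow>\<^sub>L 'b) (h'' :: 'a \<Rightarrow> 'a \<Rightarrow>\<^sub>L 'a \<Rightarrow>\<^sub>L 'b).
        (\<forall>x\<in>S. (h has_derivative blinfun_apply (h' x)) (at x within S)) \<and>
        (\<forall>x\<in>S. (h' has_derivative blinfun_apply (h'' x)) (at x within S)) \<and>
        continuous_on S h'')"

definition VI_sol :: "'b::real_inner set \<Rightarrow> ('a \<times> 'b \<Rightarrow> 'b) \<Rightarrow> 'a \<Rightarrow> 'b set" where
  "VI_sol Y G x = {y \<in> Y. \<forall>y'\<in>Y. inner (y' - y) (G (x, y)) \<ge> 0}"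

definition response :: "'b::real_inner set \<Rightarrow> ('a \<times> 'b \<Rightarrow> 'b) \<Rightarrow> 'a \<Rightarrow> 'b" where
  "response Y G x = the_elem (VI_sol Y G x)"

definition hyper_obj ::
    "'b::real_inner set \<Rightarrow> ('a \<times> 'b \<Rightarrow> 'b) \<Rightarrow> ('a \<times> 'b \<Rightarrow> real) \<Rightarrow> 'a \<Rightarrow> real" where
  "hyper_obj Y G f x = f (x, response Y G x)"

primrec follower :: "(nat \<Rightarrow> 'b \<Rightarrow> 'a \<Rightarrow> 'b) \<Rightarrow> nat \<Rightarrow> 'b \<Rightarrow> 'a \<Rightarrow> 'b" where
  "follower H 0 y x = y"
| "follower H (Suc k) y x = H k (follower H k y x) x"

text \<open>
  The state after \<open>t\<close> outer iterations, as the triple \<open>(x\<^sub>t, y\<^sub>t\<^sup>(\<^sup>0\<^sup>), y~\<^sub>t\<^sup>(\<^sup>0\<^sup>))\<close>, when the sampled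
  directions are \<open>v 0, v 1, \<dots>\<close>.
\<close>

primrec two_loop ::
    "nat \<Rightarrow> (rseq \<times> 'b \<Rightarrow> real) \<Rightarrow> (nat \<Rightarrow> 'b \<Rightarrow> rseq \<Rightarrow> 'b) \<Rightarrow> nat \<Rightarrow> (nat \<Rightarrow> real) \<Rightarrow> (nat \<Rightarrow> real) \<Rightarrow>
     rseq \<Rightarrow> 'b \<Rightarrow> 'b \<Rightarrow> (nat \<Rightarrow> rseq) \<Rightarrow> nat \<Rightarrow> rseq \<times> 'b \<times> 'b" where
  "two_loop d f H K \<eta> \<delta> x0 y0 yt0 v 0 = (x0, y0, yt0)"
| "two_loop d f H K \<eta> \<delta> x0 y0 yt0 v (Suc t) =
     (let (x, y, yt) = two_loop d f H K \<eta> \<delta> x0 y0 yt0 v t;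
          xh = x + \<delta> t *\<^sub>R v t;
          ytK = follower H K yt x;
          yK = follower H K y xh
      in (x - (\<eta> t * (real d / \<delta> t) * (f (xh, yK) - f (x, ytK))) *\<^sub>R v t, ytK, ytK))"

definition x_iter ::
    "nat \<Rightarrow> (rseq \<times> 'b \<Rightarrow> real) \<Rightarrow> (nat \<Rightarrow> 'b \<Rightarrow> rseq \<Rightarrow> 'b) \<Rightarrow> nat \<Rightarrow> (nat \<Rightarrow> real) \<Rightarrow> (nat \<Rightarrow> real) \<Rightarrow>
     rseq \<Rightarrow> 'b \<Rightarrow> 'b \<Rightarrow> (nat \<Rightarrow> rseq) \<Rightarrow> nat \<Rightarrow> rseq" where
  "x_iter d f H K \<eta> \<delta> x0 y0 yt0 v t = fst (two_loop d f H K \<eta> \<delta> x0 y0 yt0 v t)"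

definition step_size :: "real \<Rightarrow> nat \<Rightarrow> nat \<Rightarrow> real" where
  "step_size etab d t = etab * (real t + 1) powr (-1/2) * real d powr (-1)"

definition perturb_radius :: "real \<Rightarrow> nat \<Rightarrow> nat \<Rightarrow> real" where
  "perturb_radius deltab d t = deltab * (real t + 1) powr (-1/4) * real d powr (-1/2)"

text \<open>The directions \<open>v\<^sub>t\<close> are the coordinates of the infinite product of sphere measures.\<close>

definition directions :: "nat \<Rightarrow> (nat \<Rightarrow> rseq) measure" where
  "directions d = (\<Pi>\<^sub>M t\<in>UNIV. unif_sphere d)"

text \<open>
  Borel measurability of the update maps is what makes the iterates random variables.
\<close>

definition stackelberg_game ::
    "nat \<Rightarrow> 'b::euclidean_space set \<Rightarrow> (rseq \<times> 'b \<Rightarrow> real) \<Rightarrow> (rseq \<times> 'b \<Rightarrow> 'b) \<Rightarrow> bool" where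
  "stackelberg_game d Y f G \<longleftrightarrow>
     convex Y \<and> compact Y \<and> C2_on (Rd d \<times> Y) f \<and> C2_on (Rd d \<times> Y) G"

definition update_maps ::
    "nat \<Rightarrow> 'b::euclidean_space set \<Rightarrow> (nat \<Rightarrow> 'b \<Rightarrow> rseq \<Rightarrow> 'b) \<Rightarrow> bool" where
  "update_maps d Y H \<longleftrightarrow>
     (\<forall>k. (\<forall>y\<in>Y. \<forall>x\<in>Rd d. H k y x \<in> Y) \<and>
          (\<lambda>(y, x). H k y x) \<in> borel_measurable (restrict_space borel (Y \<times> Rd d)))"

definition lipschitz_smooth_conditions ::
    "nat \<Rightarrow> 'b::euclidean_space set \<Rightarrow> (rseq \<times> 'b \<Rightarrow> real) \<Rightarrow> (rseq \<times> 'b \<Rightarrow> 'b) \<Rightarrow>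
     real \<Rightarrow> real \<Rightarrow> real \<Rightarrow> real \<Rightarrow> real \<Rightarrow> real \<Rightarrow> bool" where
  "lipschitz_smooth_conditions d Y f G Lx Ly ly LS Lt lt \<longleftrightarrow>
     (\<forall>y\<in>Y. Lx-lipschitz_on (Rd d) (\<lambda>x. f (x, y))) \<and>
     (\<forall>x\<in>Rd d. Ly-lipschitz_on Y (\<lambda>y. f (x, y)) \<and> smooth_on_set ly Y (\<lambda>y. f (x, y))) \<and>
     (\<forall>x\<in>Rd d. is_singleton (VI_sol Y G x)) \<and>
     LS-lipschitz_on (Rd d) (response Y G) \<and>
     C2_on (Rd d) (hyper_obj Y G f) \<and>
     Lt-lipschitz_on (Rd d) (hyper_obj Y G f) \<and>
     lt-lipschitz_on (Rd d) (grad d (hyper_obj Y G f))"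

definition stable_updates ::
    "nat \<Rightarrow> 'b::euclidean_space set \<Rightarrow> (nat \<Rightarrow> 'b \<Rightarrow> rseq \<Rightarrow> 'b) \<Rightarrow> nat \<Rightarrow> real \<Rightarrow> bool" where
  "stable_updates d Y H K C \<longleftrightarrow>
     C > 0 \<and>
     (\<forall>y\<in>Y. \<forall>x\<in>Rd d. \<forall>xh\<in>Rd d.
        norm (follower H K y x - follower H K y xh) \<le> C * norm (x - xh))"

definition poly_rate ::
    "nat \<Rightarrow> 'b::euclidean_space set \<Rightarrow> (rseq \<times> 'b \<Rightarrow> 'b) \<Rightarrow> (nat \<Rightarrow> 'b \<Rightarrow> rseq \<Rightarrow> 'b) \<Rightarrow>
     real \<Rightarrow> real \<Rightarrow> bool" where
  "poly_rate d Y G H C lam \<longleftrightarrow>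
     C > 0 \<and> lam > 0 \<and>
     (\<forall>n\<ge>1. \<forall>x\<in>Rd d. \<forall>y\<in>Y.
        (norm (follower H n y x - response Y G x))\<^sup>2
          \<le> C * real n powr (- lam) * (norm (y - response Y G x))\<^sup>2)"

definition exp_rate ::
    "nat \<Rightarrow> 'b::euclidean_space set \<Rightarrow> (rseq \<times> 'b \<Rightarrow> 'b) \<Rightarrow> (nat \<Rightarrow> 'b \<Rightarrow> rseq \<Rightarrow> 'b) \<Rightarrow>
     real \<Rightarrow> real \<Rightarrow> bool" where
  "exp_rate d Y G H C \<rho> \<longleftrightarrow>
     C > 0 \<and> 0 \<le> \<rho> \<and> \<rho> < 1 \<and>
     (\<forall>n\<ge>1. \<forall>x\<in>Rd d. \<forall>y\<in>Y.
        norm (follower H n y x - response Y G x) \<le> C * \<rho> ^ n * norm (y - response Y G x))"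

end

theory Submission
  imports Defs
begin

text \<open>
  Why the rate holds.  Write \<open>F\<close> for the hyper-objective, \<open>X\<^sub>t\<close> for the leader's iterates and
  \<open>v\<^sub>t\<close> for the sampled directions.  A step moves the leader along \<open>v\<^sub>t\<close> by the step size times a
  finite-difference slope.  If the followers answered exactly, this slope would be \<open>d\<close> times the
  derivative of \<open>F\<close> along \<open>v\<^sub>t\<close>, up to a smoothness error of order \<open>d \<delta>\<^sub>t\<close>.  Since \<open>v\<^sub>t\<close> is independent
  of the past and isotropic (\<open>second_moment_unif_sphere\<close>), the expected squared derivative along \<open>v\<^sub>t\<close>
  is a \<open>d\<close>-th of the squared gradient norm (\<open>expectation_squared_projection\<close>), so each step decreases
  the expected objective by a multiple of the expected squared gradient norm, minus error terms.

  The delicate error is the bias due to inexact followers, because it is amplified by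
  \<open>d / \<delta>\<^sub>t\<close>, which grows with \<open>t\<close>.  Warm starting keeps it bounded.  One call to the follower routine contracts
  the distance to the equilibrium by a factor \<open>\<beta>\<close> with \<open>\<beta>\<^sup>2\<close> proportional to \<open>\<alpha>\<close>, and between two calls
  the equilibrium moves by at most a multiple of the leader's displacement.  That displacement is
  \<open>O((t + 1) powr (-1/4))\<close> (\<open>movement\<close>), hence so are the follower errors, with an additional
  factor \<open>\<beta>\<close> (\<open>err_le\<close>, \<open>err_hat_le\<close>).  This cancels the growth of \<open>d / \<delta>\<^sub>t\<close> exactly and leaves a squared
  bias of order \<open>\<alpha> d\<^sup>3\<close>, uniformly in \<open>t\<close> (\<open>bias\<close>).

  Along every single sample path this gives the descent inequality \<open>descent\<close>.  Summing it over \<open>t\<close>,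
  taking expectations and dividing by the sum of the step sizes, which is at least of order
  \<open>sqrt T / d\<close>, yields the rate (\<open>min_expected_gradient\<close>); the logarithm is the sum of
  the error terms of order \<open>1 / (t + 1)\<close>, which come from the squared step sizes and from the smoothness
  error of the slope.

  The contraction argument requires \<open>\<alpha> d\<^sup>3\<close> to be below a constant.  In the opposite case
  the bound is trivial: the gradient of \<open>F\<close> is bounded by the Lipschitz constant of \<open>F\<close>, and the
  right-hand side is bounded below by a positive constant times \<open>A\<close>.
\<close>

section \<open>The Euclidean space of finitely supported sequences\<close>

definition unit_vec :: "nat \<Rightarrow> rseq" where
  "unit_vec i = Abs_rseq (\<lambda>j. if j = i then 1 else 0)"

lemma coord_unit_vec: "coord (unit_vec i) j = (if j = i then 1 else 0)"
  unfolding unit_vec_def by (subst Abs_rseq_inverse) auto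

lemma coord_of_coords: "coord (of_coords d u) i = (if i < d then u i else 0)"
  unfolding of_coords_def by (subst Abs_rseq_inverse) (auto intro: rev_finite_subset[of "{..<d}"])

lemma coord_sum: "coord (sum g I) i = (\<Sum>j\<in>I. coord (g j) i)"
  by (induction I rule: infinite_finite_induct) (auto simp: zero_rseq.rep_eq plus_rseq.rep_eq)

lemma coord_diff: "coord (x - y) i = coord x i - coord y i"
  unfolding minus_rseq_def plus_rseq.rep_eq uminus_rseq.rep_eq by simp

lemmas coord_simps = coord_unit_vec coord_of_coords coord_sum coord_diff
  zero_rseq.rep_eq plus_rseq.rep_eq uminus_rseq.rep_eq scaleR_rseq.rep_eq

lemma coord_eq_inner_unit_vec: "coord x i = inner (unit_vec i) x"
proof -
  have "inner (unit_vec i) x = (\<Sum>j\<in>{i}. coord (unit_vec i) j * coord x j)"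
    by (rule inner_rseq_superset) (auto simp: coord_unit_vec)
  then show ?thesis by (simp add: coord_unit_vec)
qed

lemma norm_unit_vec [simp]: "norm (unit_vec i) = 1"
  by (simp add: norm_eq_sqrt_inner coord_eq_inner_unit_vec[symmetric] coord_unit_vec)

lemma of_coords_eq_sum: "of_coords d u = (\<Sum>i<d. u i *\<^sub>R unit_vec i)"
proof (rule rseq_eqI)
  fix j
  have "(\<Sum>i<d. u i * (if j = i then 1 else 0)) = (\<Sum>i<d. if i = j then u i else 0)"
    by (intro sum.cong) auto
  then show "coord (of_coords d u) j = coord (\<Sum>i<d. u i *\<^sub>R unit_vec i) j"
    by (simp add: coord_simps)
qed

lemma of_coords_coord: "x \<in> Rd d \<Longrightarrow> of_coords d (coord x) = x"
  by (auto intro!: rseq_eqI simp: coord_simps Rd_def not_less)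

lemma of_coords_in_Rd [simp, intro]: "of_coords d u \<in> Rd d"
  by (simp add: Rd_def coord_simps)

lemma norm_of_coords_le: "norm (of_coords d u) \<le> (\<Sum>i<d. \<bar>u i\<bar>)"
  unfolding of_coords_eq_sum by (rule order_trans[OF norm_sum]) simp

lemma subspace_Rd: "subspace (Rd d)"
  by (auto simp: subspace_def Rd_def coord_simps)

lemma inner_Rd_eq_sum: "x \<in> Rd d \<Longrightarrow> inner x y = (\<Sum>i<d. coord x i * coord y i)"
  by (rule inner_rseq_superset) (auto simp: Rd_def not_le[symmetric])

lemma coord_abs_le_norm: "\<bar>coord x i\<bar> \<le> norm x"
  using Cauchy_Schwarz_ineq2[of "unit_vec i" x] by (simp add: coord_eq_inner_unit_vec)

lemma closed_Rd: "closed (Rd d)"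
proof -
  have "Rd d = (\<Inter>i\<in>{d..}. {x. inner (unit_vec i) x = 0})"
    by (auto simp: Rd_def coord_eq_inner_unit_vec)
  moreover have "closed {x. inner (unit_vec i) x = 0}" for i
    by (intro closed_Collect_eq continuous_intros)
  ultimately show ?thesis by auto
qed

lemma countable_dense_rseq:
  "\<exists>Q::rseq set. countable Q \<and> (\<forall>x. \<forall>e>0. \<exists>q\<in>Q. dist q x < e)"
proof (intro exI conjI allI impI)
  let ?q = "\<lambda>l. of_coords (length l) (\<lambda>i. of_rat (l ! i))"
  show "countable (range ?q)" by simp
  fix x :: rseq and e :: real assume e: "e > 0"
  obtain n where n: "\<And>i. coord x i \<noteq> 0 \<Longrightarrow> i < n"
    using finite_nat_set_iff_bounded[of "{i. coord x i \<noteq> 0}"] by auto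
  have x: "x = of_coords n (coord x)"
    by (rule of_coords_coord[symmetric]) (use n in \<open>force simp: Rd_def not_less[symmetric]\<close>)
  have "\<exists>r::rat. \<bar>of_rat r - coord x i\<bar> < e / (real n + 1)" for i
  proof -
    have "coord x i - e / (real n + 1) < coord x i + e / (real n + 1)"
      using e by simp
    from of_rat_dense[OF this] show ?thesis by (auto simp: abs_less_iff field_simps)
  qed
  then obtain r where r: "\<And>i. \<bar>of_rat (r i) - coord x i\<bar> < e / (real n + 1)" by metis
  let ?l = "map r [0..<n]"
  have "?q ?l - x = of_coords n (\<lambda>i. of_rat (r i) - coord x i)"
    by (subst x) (auto intro!: rseq_eqI simp: coord_simps)
  then have "norm (?q ?l - x) \<le> (\<Sum>i<n. \<bar>of_rat (r i) - coord x i\<bar>)"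
    using norm_of_coords_le by metis
  also have "\<dots> \<le> (\<Sum>i<n. e / (real n + 1))"
    by (intro sum_mono less_imp_le r)
  also have "\<dots> < e" using e by (simp add: field_simps)
  finally show "\<exists>q\<in>range ?q. dist q x < e"
    unfolding dist_norm by (rule bexI[OF _ rangeI])
qed

text \<open>Second countability makes the Borel sets of a product the product of the Borel sets, which is
  what the measurability of sums and pairs of random vectors rests on.\<close>

instance rseq :: second_countable_topology
proof
  obtain Q :: "rseq set" where Q: "countable Q" "\<And>x e. e > 0 \<Longrightarrow> \<exists>q\<in>Q. dist q x < e"
    using countable_dense_rseq by metis
  let ?B = "(\<lambda>(q, n). ball q (1 / real (Suc n))) ` (Q \<times> UNIV)"
  have "topological_basis ?B"
  proof (rule topological_basisI)
    fix U and x :: rseq assume "open U" "x \<in> U"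
    then obtain e where e: "e > 0" "ball x e \<subseteq> U" by (meson openE)
    obtain n where n: "1 / real (Suc n) < e / 2"
      using e nat_approx_posE[of "e / 2"] by auto
    obtain q where q: "q \<in> Q" "dist q x < 1 / real (Suc n)"
      using Q(2)[of "1 / real (Suc n)" x] by auto
    have "ball q (1 / real (Suc n)) \<subseteq> ball x e"
    proof
      fix y assume "y \<in> ball q (1 / real (Suc n))"
      then have "dist q y < 1 / real (Suc n)" by simp
      moreover have "dist x y \<le> dist q x + dist q y" by (metis dist_commute dist_triangle)
      ultimately show "y \<in> ball x e" using q n by simp
    qed
    then show "\<exists>B\<in>?B. x \<in> B \<and> B \<subseteq> U" using q e by (intro bexI[of _ "ball q (1 / real (Suc n))"]) auto
  qed auto
  moreover have "countable ?B" using Q(1) by auto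
  ultimately show "\<exists>B::rseq set set. countable B \<and> open = generate_topology B"
    using topological_basis_imp_subbasis by blast
qed

lemma borel_measurable_of_coords:
  "of_coords d \<in> borel_measurable (\<Pi>\<^sub>M i\<in>{..<d}. lborel)"
  unfolding of_coords_eq_sum[abs_def]
  by (intro borel_measurable_sum borel_measurable_scaleR borel_measurable_const) simp

lemma borel_measurable_coord [measurable]: "(\<lambda>x. coord x i) \<in> borel_measurable borel"
  unfolding coord_eq_inner_unit_vec
  by (intro borel_measurable_continuous_onI continuous_intros)

section \<open>Gradients of smooth functions\<close>

text \<open>A derivative within a subspace only sees increments from the subspace, so it may be replaced by
  any bounded linear map that agrees with it there.  This is what lets a gradient be chosen inside
  \<open>\<real>\<^sup>d\<close>, although the given derivative is a functional on the whole space.\<close>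

lemma has_derivative_within_cong_subspace:
  assumes "(h has_derivative D) (at x within S)" "subspace S" "x \<in> S"
    and "bounded_linear D'" "\<And>u. u \<in> S \<Longrightarrow> D' u = D u"
  shows "(h has_derivative D') (at x within S)"
  using assms(1) unfolding has_derivative_within_alt
  by (simp add: assms(3-5) subspace_diff[OF assms(2)])

lemma gradient_within_Rd_exists:
  assumes "(h has_derivative D) (at x within Rd d)" "x \<in> Rd d"
  shows "\<exists>g\<in>Rd d. gradient_within (Rd d) h x g"
proof
  let ?g = "of_coords d (\<lambda>i. D (unit_vec i))"
  interpret D: bounded_linear D using assms(1) by (rule has_derivative_bounded_linear)
  show "?g \<in> Rd d" by simp
  have eq: "inner ?g u = D u" if "u \<in> Rd d" for u
  proof -
    have "D u = D (\<Sum>i<d. coord u i *\<^sub>R unit_vec i)"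
      using of_coords_coord[OF that] by (simp add: of_coords_eq_sum)
    also have "\<dots> = (\<Sum>i<d. coord u i * D (unit_vec i))"
      by (simp add: D.sum D.scaleR)
    also have "\<dots> = inner ?g u"
      by (subst inner_Rd_eq_sum[of _ d]) (auto simp: coord_simps mult.commute)
    finally show ?thesis ..
  qed
  show "gradient_within (Rd d) h x ?g" unfolding gradient_within_def
    by (rule has_derivative_within_cong_subspace[OF assms(1) subspace_Rd assms(2)])
      (auto simp: eq bounded_linear_inner_right)
qed

text \<open>Restricting to a segment reduces statements about gradients within a subspace to
  one-variable calculus.\<close>

lemma gradient_within_segment:
  assumes "gradient_within (Rd d) h (x + s *\<^sub>R u) g" "x \<in> Rd d" "u \<in> Rd d"
  shows "((\<lambda>s. h (x + s *\<^sub>R u)) has_derivative (\<lambda>r. r * inner g u)) (at s within A)"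
proof -
  have "((\<lambda>s. x + s *\<^sub>R u) has_derivative (\<lambda>r. r *\<^sub>R u)) (at s within A)"
    by (auto intro!: derivative_eq_intros)
  moreover have "(h has_derivative inner g) (at (x + s *\<^sub>R u) within (\<lambda>s. x + s *\<^sub>R u) ` A)"
    using assms(1) unfolding gradient_within_def
    by (rule has_derivative_subset)
      (auto intro: subspace_add[OF subspace_Rd] subspace_scale[OF subspace_Rd] assms)
  ultimately have "((\<lambda>s. h (x + s *\<^sub>R u)) has_derivative (\<lambda>r. inner g (r *\<^sub>R u))) (at s within A)"
    by (rule has_derivative_in_compose[of "\<lambda>s. x + s *\<^sub>R u" _ s A h])
  then show ?thesis by simp
qed

lemma gradient_within_Rd_unique:
  assumes "gradient_within (Rd d) h x g" "gradient_within (Rd d) h x g'"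
    and "x \<in> Rd d" "g \<in> Rd d" "g' \<in> Rd d"
  shows "g = g'"
proof -
  have u: "g - g' \<in> Rd d" using assms subspace_diff[OF subspace_Rd] by auto
  have "((\<lambda>s. h (x + s *\<^sub>R (g - g'))) has_derivative (\<lambda>r. r * inner g (g - g'))) (at 0)"
    by (rule gradient_within_segment) (use assms u in auto)
  moreover have "((\<lambda>s. h (x + s *\<^sub>R (g - g'))) has_derivative (\<lambda>r. r * inner g' (g - g'))) (at 0)"
    by (rule gradient_within_segment) (use assms u in auto)
  ultimately have "(\<lambda>r. r * inner g (g - g')) = (\<lambda>r. r * inner g' (g - g'))"
    by (rule has_derivative_unique)
  from fun_cong[OF this, of 1] have "inner (g - g') (g - g') = 0"
    by (simp add: inner_diff_left)
  then show ?thesis by simp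
qed

lemma grad_works:
  assumes "C2_on (Rd d) h" "x \<in> Rd d"
  shows "grad d h x \<in> Rd d" "gradient_within (Rd d) h x (grad d h x)"
proof -
  obtain D where "(h has_derivative D) (at x within Rd d)"
    using assms unfolding C2_on_def by blast
  then have "\<exists>g. g \<in> Rd d \<and> gradient_within (Rd d) h x g"
    using gradient_within_Rd_exists assms(2) by blast
  then have "\<exists>!g. g \<in> Rd d \<and> gradient_within (Rd d) h x g"
    using gradient_within_Rd_unique assms(2) by blast
  from theI'[OF this] show "grad d h x \<in> Rd d" "gradient_within (Rd d) h x (grad d h x)"
    unfolding grad_def by auto
qed

text \<open>The derivative along the gradient direction is the squared norm of the gradient, and it is at
  most \<open>L\<close> times the norm.\<close>

lemma norm_grad_le_lipschitz:
  assumes "C2_on (Rd d) h" "L-lipschitz_on (Rd d) h" "x \<in> Rd d"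
  shows "norm (grad d h x) \<le> L"
proof -
  let ?g = "grad d h x"
  note g = grad_works[OF assms(1,3)]
  have Rd: "x + s *\<^sub>R ?g \<in> Rd d" for s
    using assms g by (intro subspace_add[OF subspace_Rd] subspace_scale[OF subspace_Rd])
  have "((\<lambda>s. h (x + s *\<^sub>R ?g)) has_derivative (\<lambda>r. r * inner ?g ?g)) (at 0)"
    by (rule gradient_within_segment) (use assms g in auto)
  then have "((\<lambda>s. h (x + s *\<^sub>R ?g)) has_field_derivative inner ?g ?g) (at 0)"
    unfolding has_field_derivative_def by (rule has_derivative_eq_rhs) (auto simp: mult.commute)
  then have lim: "((\<lambda>s. (h (x + s *\<^sub>R ?g) - h x) / s) \<longlongrightarrow> inner ?g ?g) (at 0)"
    by (simp add: has_field_derivative_iff)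
  have "(h (x + s *\<^sub>R ?g) - h x) / s \<le> L * norm ?g" if "s \<noteq> 0" for s
  proof -
    have "\<bar>h (x + s *\<^sub>R ?g) - h x\<bar> \<le> L * (\<bar>s\<bar> * norm ?g)"
      using lipschitz_onD[OF assms(2) Rd[of s] assms(3)] by (simp add: dist_norm)
    then have "\<bar>(h (x + s *\<^sub>R ?g) - h x) / s\<bar> \<le> L * norm ?g"
      using that by (simp add: field_simps)
    then show ?thesis by linarith
  qed
  then have "inner ?g ?g \<le> L * norm ?g"
    by (intro tendsto_upperbound[OF lim]) (auto simp: eventually_at_filter)
  then have "norm ?g * norm ?g \<le> L * norm ?g"
    by (simp add: power2_norm_eq_inner[symmetric] power2_eq_square)
  then show ?thesis
    using lipschitz_on_nonneg[OF assms(2)] by (cases "norm ?g = 0") auto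
qed

text \<open>The mean value theorem suffices here.  Integrating the gradient along the segment would halve the
  constant, which does not affect the rate.\<close>

lemma smooth_linearization_error:
  assumes "C2_on (Rd d) h" "l-lipschitz_on (Rd d) (grad d h)" "x \<in> Rd d" "u \<in> Rd d"
  shows "\<bar>h (x + u) - h x - inner (grad d h x) u\<bar> \<le> l * (norm u)\<^sup>2"
proof -
  have Rd: "x + s *\<^sub>R u \<in> Rd d" for s
    using assms by (intro subspace_add[OF subspace_Rd] subspace_scale[OF subspace_Rd])
  have "\<exists>s\<in>{0<..<1}. h (x + 1 *\<^sub>R u) - h (x + 0 *\<^sub>R u) = (1 - 0) * inner (grad d h (x + s *\<^sub>R u)) u"
    by (rule mvt_simple) (auto intro!: gradient_within_segment grad_works Rd assms)
  then obtain s where s: "0 < s" "s < 1" "h (x + u) - h x = inner (grad d h (x + s *\<^sub>R u)) u"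
    by auto
  have "\<bar>h (x + u) - h x - inner (grad d h x) u\<bar> = \<bar>inner (grad d h (x + s *\<^sub>R u) - grad d h x) u\<bar>"
    using s by (simp add: inner_diff_left)
  also have "\<dots> \<le> norm (grad d h (x + s *\<^sub>R u) - grad d h x) * norm u"
    by (rule Cauchy_Schwarz_ineq2)
  also have "\<dots> \<le> (l * norm u) * norm u"
  proof (rule mult_right_mono)
    have "norm (grad d h (x + s *\<^sub>R u) - grad d h x) \<le> l * (s * norm u)"
      using lipschitz_onD[OF assms(2) Rd[of s] assms(3)] s by (simp add: dist_norm)
    also have "\<dots> \<le> l * norm u"
      using s lipschitz_on_nonneg[OF assms(2)] by (intro mult_left_mono mult_left_le_one_le) auto
    finally show "norm (grad d h (x + s *\<^sub>R u) - grad d h x) \<le> l * norm u" .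
  qed simp
  finally show ?thesis by (simp add: power2_eq_square mult.assoc)
qed

section \<open>The uniform distribution on the sphere\<close>

abbreviation lebesgue_coords :: "nat \<Rightarrow> (nat \<Rightarrow> real) measure" where
  "lebesgue_coords d \<equiv> (\<Pi>\<^sub>M i\<in>{..<d}. lborel)"

definition unit_ball_coords :: "nat \<Rightarrow> (nat \<Rightarrow> real) set" where
  "unit_ball_coords d = {u \<in> {..<d} \<rightarrow>\<^sub>E UNIV. norm (of_coords d u) \<le> 1}"

abbreviation unif_ball :: "nat \<Rightarrow> (nat \<Rightarrow> real) measure" where
  "unif_ball d \<equiv> uniform_measure (lebesgue_coords d) (unit_ball_coords d)"

definition sphere_Rd :: "nat \<Rightarrow> rseq set" where
  "sphere_Rd d = {v \<in> Rd d. norm v = 1}"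

interpretation lborel_product: product_sigma_finite "\<lambda>_::nat. lborel :: real measure"
  by standard

lemma unit_ball_coords_sets: "unit_ball_coords d \<in> sets (lebesgue_coords d)"
proof -
  have "unit_ball_coords d = (\<lambda>u. norm (of_coords d u)) -` {..1} \<inter> space (lebesgue_coords d)"
    by (auto simp: unit_ball_coords_def space_PiM)
  also have "\<dots> \<in> sets (lebesgue_coords d)"
    using borel_measurable_of_coords by (intro measurable_sets[of _ _ borel] borel_measurable_norm) auto
  finally show ?thesis .
qed

lemma emeasure_unit_ball_coords_pos:
  assumes "d \<ge> 1" shows "emeasure (lebesgue_coords d) (unit_ball_coords d) \<noteq> 0"
proof -
  let ?Q = "\<Pi>\<^sub>E i\<in>{..<d}. {0..1 / real d}"
  have "?Q \<subseteq> unit_ball_coords d"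
  proof
    fix u assume u: "u \<in> ?Q"
    have "norm (of_coords d u) \<le> (\<Sum>i<d. \<bar>u i\<bar>)" by (rule norm_of_coords_le)
    also have "\<dots> \<le> (\<Sum>i<d. 1 / real d)"
      using u by (intro sum_mono) (auto simp: PiE_iff)
    also have "\<dots> = 1" using assms by simp
    finally show "u \<in> unit_ball_coords d" using u by (auto simp: unit_ball_coords_def PiE_iff)
  qed
  then have "emeasure (lebesgue_coords d) ?Q \<le> emeasure (lebesgue_coords d) (unit_ball_coords d)"
    using unit_ball_coords_sets by (rule emeasure_mono)
  moreover have "emeasure (lebesgue_coords d) ?Q = ennreal ((1 / real d) ^ d)"
    by (subst lborel_product.emeasure_PiM) (auto simp: ennreal_power)
  ultimately show ?thesis using assms by auto
qed

lemma emeasure_unit_ball_coords_finite: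
  "emeasure (lebesgue_coords d) (unit_ball_coords d) \<noteq> \<infinity>"
proof -
  let ?Q = "\<Pi>\<^sub>E i\<in>{..<d}. {-1..1::real}"
  have "unit_ball_coords d \<subseteq> ?Q"
  proof
    fix u assume u: "u \<in> unit_ball_coords d"
    have "\<bar>u i\<bar> \<le> 1" if "i < d" for i
      using coord_abs_le_norm[of "of_coords d u" i] u that
      by (auto simp: unit_ball_coords_def coord_of_coords)
    then show "u \<in> ?Q" using u by (auto simp: unit_ball_coords_def PiE_iff abs_le_iff)
  qed
  then have "emeasure (lebesgue_coords d) (unit_ball_coords d) \<le> emeasure (lebesgue_coords d) ?Q"
    by (rule emeasure_mono) (auto intro!: sets_PiM_I_finite)
  also have "\<dots> = 2 ^ d"
    by (subst lborel_product.emeasure_PiM) auto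
  finally show ?thesis by (auto simp: top_unique power_eq_top_ennreal)
qed

lemma sphere_Rd_closed: "closed (sphere_Rd d)"
proof -
  have "sphere_Rd d = Rd d \<inter> {v. norm v = 1}" by (auto simp: sphere_Rd_def)
  moreover have "closed {v::rseq. norm v = 1}" by (intro closed_Collect_eq continuous_intros)
  ultimately show ?thesis using closed_Rd by auto
qed

lemma borel_measurable_sgn_rseq: "(sgn :: rseq \<Rightarrow> rseq) \<in> borel_measurable borel"
  unfolding sgn_rseq_def[abs_def] by measurable

lemma sgn_of_coords_measurable:
  "(\<lambda>u. sgn (of_coords d u)) \<in> borel_measurable (unif_ball d)"
  using measurable_compose[OF borel_measurable_of_coords borel_measurable_sgn_rseq] by simp

lemma sgn_of_coords_cases: "of_coords d u = 0 \<or> sgn (of_coords d u) \<in> sphere_Rd d"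
  by (auto simp: sphere_Rd_def norm_sgn sgn_div_norm intro: subspace_scale[OF subspace_Rd])

lemma unif_sphere_eq:
  "unif_sphere d =
    restrict_space (distr (unif_ball d) borel (\<lambda>u. sgn (of_coords d u))) (sphere_Rd d)"
  by (simp add: unif_sphere_def unit_ball_coords_def sphere_Rd_def)

lemma space_unif_sphere: "space (unif_sphere d) = sphere_Rd d"
  by (simp add: unif_sphere_eq space_restrict_space)

lemma sets_unif_sphere: "sets (unif_sphere d) = sets (restrict_space borel (sphere_Rd d))"
  by (simp add: unif_sphere_eq sets_restrict_space)

lemma prob_space_unif_ball: "d \<ge> 1 \<Longrightarrow> prob_space (unif_ball d)"
  by (intro prob_space_uniform_measure emeasure_unit_ball_coords_pos emeasure_unit_ball_coords_finite)

text \<open>The radial projection misses the sphere only at the origin, which is a null set, so restricting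
  to the sphere loses no mass.\<close>

lemma prob_space_unif_sphere:
  assumes "d \<ge> 1" shows "prob_space (unif_sphere d)"
proof -
  interpret U: prob_space "unif_ball d" by (rule prob_space_unif_ball[OF assms])
  let ?D = "distr (unif_ball d) borel (\<lambda>u. sgn (of_coords d u))"
  interpret D: prob_space ?D
    by (rule U.prob_space_distr[OF sgn_of_coords_measurable])
  have "AE u in lebesgue_coords d. of_coords d u \<noteq> 0"
  proof (rule AE_I)
    show "{u \<in> space (lebesgue_coords d). \<not> of_coords d u \<noteq> 0} \<subseteq> (\<Pi>\<^sub>E i\<in>{..<d}. {0})"
    proof
      fix u assume u: "u \<in> {u \<in> space (lebesgue_coords d). \<not> of_coords d u \<noteq> 0}"
      then have c: "coord (of_coords d u) i = 0" for i by (simp add: zero_rseq.rep_eq)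
      have "u i = 0" if "i < d" for i using c[of i] that by (simp add: coord_of_coords)
      then show "u \<in> (\<Pi>\<^sub>E i\<in>{..<d}. {0})"
        using u by (intro PiE_I) (auto simp: space_PiM PiE_iff extensional_def)
    qed
    show "emeasure (lebesgue_coords d) (\<Pi>\<^sub>E i\<in>{..<d}. {0}) = 0"
      using assms by (subst lborel_product.emeasure_PiM) (auto simp: power_0_left)
    show "(\<Pi>\<^sub>E i\<in>{..<d}. {0::real}) \<in> sets (lebesgue_coords d)"
      by (intro sets_PiM_I_finite) auto
  qed
  then have "AE u in unif_ball d. sgn (of_coords d u) \<in> sphere_Rd d"
    by (intro AE_uniform_measureI unit_ball_coords_sets) (use sgn_of_coords_cases in fastforce)
  then have "AE v in ?D. v \<in> sphere_Rd d"
    using sphere_Rd_closed by (subst AE_distr_iff[OF sgn_of_coords_measurable]) auto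
  then have "emeasure ?D (sphere_Rd d) = 1"
    using sphere_Rd_closed by (intro D.emeasure_eq_1_AE) auto
  then show ?thesis unfolding unif_sphere_eq
    using sphere_Rd_closed by (intro prob_space_restrict_space) auto
qed

text \<open>A function vanishing at the origin cannot see the only point that projects off the sphere; this
  gives a change of variables without exceptional sets.\<close>

lemma integral_unif_sphere:
  fixes F :: "rseq \<Rightarrow> real"
  assumes "F \<in> borel_measurable borel" "F 0 = 0"
  shows "integral\<^sup>L (unif_sphere d) F = (\<integral>u. F (sgn (of_coords d u)) \<partial>unif_ball d)"
proof -
  have "integral\<^sup>L (unif_sphere d) F =
      (\<integral>v. indicator (sphere_Rd d) v *\<^sub>R F v \<partial>distr (unif_ball d) borel (\<lambda>u. sgn (of_coords d u)))"
    unfolding unif_sphere_eq using sphere_Rd_closed by (intro integral_restrict_space) auto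
  also have "\<dots> = (\<integral>u. indicator (sphere_Rd d) (sgn (of_coords d u)) *\<^sub>R F (sgn (of_coords d u)) \<partial>unif_ball d)"
    using sphere_Rd_closed assms(1) by (intro integral_distr sgn_of_coords_measurable) auto
  also have "\<dots> = (\<integral>u. F (sgn (of_coords d u)) \<partial>unif_ball d)"
    by (intro Bochner_Integration.integral_cong refl)
      (use sgn_of_coords_cases[of d] assms(2) in \<open>metis (no_types, lifting) indicator_simps
        scaleR_one scaleR_zero_left sgn_zero\<close>)
  finally show ?thesis .
qed

definition signed_swap :: "nat \<Rightarrow> (nat \<Rightarrow> real) \<Rightarrow> (nat \<Rightarrow> nat) \<Rightarrow> (nat \<Rightarrow> real) \<Rightarrow> nat \<Rightarrow> real" where
  "signed_swap d s \<pi> u = (\<lambda>i\<in>{..<d}. s i * u (\<pi> i))"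

lemma emeasure_lborel_sign_vimage:
  assumes "c = 1 \<or> c = (-1::real)" "A \<in> sets borel"
  shows "emeasure lborel {y. c * y \<in> A} = emeasure lborel A"
proof (cases "c = 1")
  case False
  then have "emeasure lborel {y. c * y \<in> A} = emeasure lborel (uminus -` A \<inter> space lborel)"
    using assms(1) by (simp add: vimage_def)
  also have "\<dots> = emeasure (distr lborel borel uminus) A"
    using assms(2) by (subst emeasure_distr) auto
  finally show ?thesis by (simp add: lborel_distr_uminus)
qed simp

text \<open>The isometries needed for the second moments: sign changes combined with a permutation of the
  coordinates.  The permutation is taken to be an involution, so that it serves as its own inverse in
  preimages; identity and transpositions are all that is used.\<close>

locale coordinate_symmetry =
  fixes d :: nat and s :: "nat \<Rightarrow> real" and \<pi> :: "nat \<Rightarrow> nat"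
  assumes sign: "\<And>i. s i = 1 \<or> s i = -1"
    and perm: "\<And>i. i < d \<Longrightarrow> \<pi> i < d" "\<And>i. i < d \<Longrightarrow> \<pi> (\<pi> i) = i"
begin

abbreviation "\<tau> \<equiv> signed_swap d s \<pi>"

lemma sum_perm: "(\<Sum>i<d. a (\<pi> i)) = (\<Sum>i<d. a i)" for a :: "nat \<Rightarrow> real"
  by (rule sum.reindex_bij_witness[of _ \<pi> \<pi>]) (auto simp: perm)

lemma prod_perm: "(\<Prod>i<d. a (\<pi> i)) = (\<Prod>i<d. a i)" for a :: "nat \<Rightarrow> ennreal"
  by (rule prod.reindex_bij_witness[of _ \<pi> \<pi>]) (auto simp: perm)

lemma measurable_\<tau>: "\<tau> \<in> measurable (lebesgue_coords d) (lebesgue_coords d)"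
proof -
  have "(\<lambda>u. s i * u (\<pi> i)) \<in> measurable (lebesgue_coords d) lborel" if "i < d" for i
  proof -
    have "(\<lambda>u. u (\<pi> i)) \<in> measurable (lebesgue_coords d) lborel"
      by (rule measurable_component_singleton) (use perm that in auto)
    then show ?thesis by simp
  qed
  then show ?thesis unfolding signed_swap_def by (intro measurable_restrict) auto
qed

lemma distr_cube_\<tau>: "distr (lebesgue_coords d) (lebesgue_coords d) \<tau> = lebesgue_coords d"
proof (rule lborel_product.PiM_eqI)
  fix A :: "nat \<Rightarrow> real set" assume A: "\<And>i. i \<in> {..<d} \<Longrightarrow> A i \<in> sets lborel"
  let ?A = "\<lambda>j. {y. s (\<pi> j) * y \<in> A (\<pi> j)}"
  have A': "A (\<pi> j) \<in> sets borel" if "j < d" for j using A[of "\<pi> j"] perm(1)[OF that] by simp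
  have "\<tau> -` (\<Pi>\<^sub>E i\<in>{..<d}. A i) \<inter> space (lebesgue_coords d) = (\<Pi>\<^sub>E j\<in>{..<d}. ?A j)"
  proof (intro set_eqI)
    fix u :: "nat \<Rightarrow> real"
    have "(\<forall>i<d. s i * u (\<pi> i) \<in> A i) \<longleftrightarrow> (\<forall>j<d. s (\<pi> j) * u j \<in> A (\<pi> j))"
      using perm by metis
    then show "u \<in> \<tau> -` (\<Pi>\<^sub>E i\<in>{..<d}. A i) \<inter> space (lebesgue_coords d) \<longleftrightarrow>
        u \<in> (\<Pi>\<^sub>E j\<in>{..<d}. ?A j)"
      by (simp add: signed_swap_def space_PiM PiE_iff Ball_def conj_commute)
  qed
  moreover have A_sets: "?A j \<in> sets lborel" if "j < d" for j
  proof -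
    have "(\<lambda>y. s (\<pi> j) * y) -` A (\<pi> j) \<inter> space lborel \<in> sets lborel"
      by (rule measurable_sets[of _ _ borel]) (use A'[OF that] in auto)
    then show ?thesis by (simp add: vimage_def)
  qed
  moreover have "emeasure (lebesgue_coords d) (\<Pi>\<^sub>E j\<in>{..<d}. ?A j) = (\<Prod>j<d. emeasure lborel (?A j))"
    by (rule lborel_product.emeasure_PiM) (use A_sets in auto)
  ultimately have "emeasure (distr (lebesgue_coords d) (lebesgue_coords d) \<tau>) (\<Pi>\<^sub>E i\<in>{..<d}. A i)
      = (\<Prod>j<d. emeasure lborel (?A j))"
    using A by (subst emeasure_distr[OF measurable_\<tau>])
      (auto intro!: sets_PiM_I_finite)
  also have "\<dots> = (\<Prod>j<d. emeasure lborel (A (\<pi> j)))"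
    by (intro prod.cong refl emeasure_lborel_sign_vimage sign A') auto
  also have "\<dots> = (\<Prod>j<d. emeasure lborel (A j))" by (rule prod_perm)
  finally show "emeasure (distr (lebesgue_coords d) (lebesgue_coords d) \<tau>) (\<Pi>\<^sub>E i\<in>{..<d}. A i) =
    (\<Prod>j\<in>{..<d}. emeasure lborel (A j))" .
qed auto

lemma norm_of_coords_\<tau>: "norm (of_coords d (\<tau> u)) = norm (of_coords d u)"
proof -
  have sq: "s i * s i = 1" for i using sign[of i] by auto
  have "inner (of_coords d (\<tau> u)) (of_coords d (\<tau> u)) = (\<Sum>i<d. (s i * s i) * (u (\<pi> i) * u (\<pi> i)))"
    by (subst inner_Rd_eq_sum[of _ d]) (auto simp: coord_of_coords signed_swap_def intro!: sum.cong)
  also have "\<dots> = (\<Sum>i<d. u i * u i)" using sum_perm[of "\<lambda>i. u i * u i"] by (simp add: sq)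
  also have "\<dots> = inner (of_coords d u) (of_coords d u)"
    by (subst inner_Rd_eq_sum[of _ d]) (auto simp: coord_of_coords)
  finally show ?thesis by (simp add: norm_eq_sqrt_inner)
qed

lemma distr_unif_ball_\<tau>: "distr (unif_ball d) (unif_ball d) \<tau> = unif_ball d"
proof (rule measure_eqI)
  let ?P = "lebesgue_coords d" and ?B = "unit_ball_coords d"
  have m: "\<tau> \<in> measurable (unif_ball d) (unif_ball d)" using measurable_\<tau> by simp
  fix X assume "X \<in> sets (distr (unif_ball d) (unif_ball d) \<tau>)"
  then have X: "X \<in> sets ?P" by simp
  have \<tau>X: "\<tau> -` X \<inter> space ?P \<in> sets ?P" by (rule measurable_sets[OF measurable_\<tau> X])
  have "\<tau> u \<in> ?B \<longleftrightarrow> u \<in> ?B" if "u \<in> space ?P" for u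
    using that norm_of_coords_\<tau>[of u] by (auto simp: unit_ball_coords_def space_PiM signed_swap_def)
  then have eq: "?B \<inter> (\<tau> -` X \<inter> space ?P) = \<tau> -` (?B \<inter> X) \<inter> space ?P"
    by auto
  have "emeasure (distr (unif_ball d) (unif_ball d) \<tau>) X
      = emeasure ?P (?B \<inter> (\<tau> -` X \<inter> space ?P)) / emeasure ?P ?B"
    using X \<tau>X by (simp add: emeasure_distr[OF m] unit_ball_coords_sets)
  also have "emeasure ?P (?B \<inter> (\<tau> -` X \<inter> space ?P)) = emeasure (distr ?P ?P \<tau>) (?B \<inter> X)"
    unfolding eq using X unit_ball_coords_sets
    by (intro emeasure_distr[OF measurable_\<tau>, symmetric]) auto
  finally show "emeasure (distr (unif_ball d) (unif_ball d) \<tau>) X = emeasure (unif_ball d) X"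
    using X by (simp add: distr_cube_\<tau> unit_ball_coords_sets)
qed simp

text \<open>Such a map preserves Lebesgue measure and the norm, hence the uniform distribution on the ball,
  and it commutes with the radial projection.\<close>

lemma second_moment_symmetry:
  assumes "i < d" "j < d"
  shows "(\<integral>v. coord v i * coord v j \<partial>unif_sphere d) =
    s i * s j * (\<integral>v. coord v (\<pi> i) * coord v (\<pi> j) \<partial>unif_sphere d)"
proof -
  let ?c = "\<lambda>i u. coord (sgn (of_coords d u)) i"
  have c_\<tau>: "?c i (\<tau> u) = s i * ?c (\<pi> i) u" if "i < d" for i u
  proof -
    have "coord (of_coords d (\<tau> u)) i = s i * coord (of_coords d u) (\<pi> i)"
      using that perm by (simp add: coord_of_coords signed_swap_def)
    then show ?thesis
      by (simp add: sgn_div_norm norm_of_coords_\<tau> scaleR_rseq.rep_eq)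
  qed
  have m: "\<tau> \<in> measurable (unif_ball d) (unif_ball d)" using measurable_\<tau> by simp
  have meas: "(\<lambda>u. ?c i u * ?c j u) \<in> borel_measurable (unif_ball d)" for i j
    by (intro borel_measurable_times measurable_compose[OF sgn_of_coords_measurable]
        borel_measurable_coord)
  have "(\<integral>v. coord v i * coord v j \<partial>unif_sphere d) = (\<integral>u. ?c i u * ?c j u \<partial>unif_ball d)"
    by (rule integral_unif_sphere) (auto simp: zero_rseq.rep_eq)
  also have "\<dots> = (\<integral>u. ?c i u * ?c j u \<partial>distr (unif_ball d) (unif_ball d) \<tau>)"
    by (simp only: distr_unif_ball_\<tau>)
  also have "\<dots> = (\<integral>u. ?c i (\<tau> u) * ?c j (\<tau> u) \<partial>unif_ball d)"
    by (rule integral_distr[OF m meas])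
  also have "\<dots> = (\<integral>u. (s i * s j) * (?c (\<pi> i) u * ?c (\<pi> j) u) \<partial>unif_ball d)"
    by (simp add: c_\<tau> assms mult_ac)
  also have "\<dots> = s i * s j * (\<integral>u. ?c (\<pi> i) u * ?c (\<pi> j) u \<partial>unif_ball d)"
    by (rule Bochner_Integration.integral_mult_right_zero)
  also have "(\<integral>u. ?c (\<pi> i) u * ?c (\<pi> j) u \<partial>unif_ball d) =
      (\<integral>v. coord v (\<pi> i) * coord v (\<pi> j) \<partial>unif_sphere d)"
    by (rule integral_unif_sphere[symmetric]) (auto simp: zero_rseq.rep_eq)
  finally show ?thesis .
qed

end

lemma integrable_unif_sphere_coord_mult:
  assumes "d \<ge> 1"
  shows "integrable (unif_sphere d) (\<lambda>v. coord v i * coord v j)"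
proof -
  interpret prob_space "unif_sphere d" by (rule prob_space_unif_sphere[OF assms])
  have "\<bar>coord v i * coord v j\<bar> \<le> 1" if "v \<in> sphere_Rd d" for v
    using coord_abs_le_norm[of v i] coord_abs_le_norm[of v j] that
    by (auto simp: abs_mult sphere_Rd_def intro: mult_le_one)
  moreover have "(\<lambda>v. coord v i * coord v j) \<in> borel_measurable (unif_sphere d)"
    by (subst measurable_cong_sets[OF sets_unif_sphere refl])
      (auto intro!: measurable_restrict_space1)
  ultimately show ?thesis
    by (intro integrable_const_bound[of _ 1]) (auto simp: space_unif_sphere)
qed

text \<open>Flipping one sign makes mixed moments vanish; swapping coordinates makes the pure moments
  equal, and these add up to the squared radius.\<close>

lemma second_moment_unif_sphere:
  assumes "i < d" "j < d"
  shows "(\<integral>v. coord v i * coord v j \<partial>unif_sphere d) = (if i = j then 1 / real d else 0)"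
proof -
  let ?M = "\<lambda>i j. \<integral>v. coord v i * coord v j \<partial>unif_sphere d"
  have d: "d \<ge> 1" using assms by simp
  interpret prob_space "unif_sphere d" by (rule prob_space_unif_sphere[OF d])
  show ?thesis
  proof (cases "i = j")
    case False
    interpret coordinate_symmetry d "\<lambda>k. if k = i then -1 else 1" "\<lambda>k. k"
      by standard auto
    show ?thesis using second_moment_symmetry[OF assms] False by simp
  next
    case True
    have eq: "?M k k = ?M i i" if "k < d" for k
    proof -
      interpret coordinate_symmetry d "\<lambda>_. 1" "\<lambda>l. if l = k then i else if l = i then k else l"
        by standard (use assms that in auto)
      show ?thesis using second_moment_symmetry[OF that that] by simp
    qed
    have "real d * ?M i i = (\<Sum>k<d. ?M k k)" using eq by simp
    also have "\<dots> = (\<integral>v. (\<Sum>k<d. coord v k * coord v k) \<partial>unif_sphere d)"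
      by (rule Bochner_Integration.integral_sum[symmetric], rule integrable_unif_sphere_coord_mult[OF d])
    also have "\<dots> = (\<integral>v. 1 \<partial>unif_sphere d)"
      by (intro Bochner_Integration.integral_cong refl)
        (auto simp: space_unif_sphere sphere_Rd_def inner_Rd_eq_sum[symmetric]
          power2_norm_eq_inner[symmetric])
    finally show ?thesis using True d by (simp add: prob_space field_simps)
  qed
qed

lemma unif_sphere_isotropic:
  assumes "d \<ge> 1" "g \<in> Rd d"
  shows "(\<integral>v. (inner g v)\<^sup>2 \<partial>unif_sphere d) = (norm g)\<^sup>2 / real d"
proof -
  let ?a = "coord g"
  have "(\<integral>v. (inner g v)\<^sup>2 \<partial>unif_sphere d) =
      (\<integral>v. (\<Sum>i<d. \<Sum>j<d. (?a i * ?a j) * (coord v i * coord v j)) \<partial>unif_sphere d)"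
    by (simp add: inner_Rd_eq_sum[OF assms(2)] power2_eq_square sum_product mult_ac)
  also have "\<dots> = (\<Sum>i<d. \<Sum>j<d. (?a i * ?a j) * (\<integral>v. coord v i * coord v j \<partial>unif_sphere d))"
    by (simp add: integrable_unif_sphere_coord_mult[OF assms(1)])
  also have "\<dots> = (\<Sum>i<d. ?a i * ?a i * (1 / real d))"
    by (intro sum.cong refl) (simp add: second_moment_unif_sphere if_distrib cong: if_cong)
  also have "\<dots> = (norm g)\<^sup>2 / real d"
    by (simp add: power2_norm_eq_inner inner_Rd_eq_sum[OF assms(2)] sum_divide_distrib)
  finally show ?thesis .
qed

section \<open>Independence of the sampled directions\<close>

lemma prob_space_directions: "d \<ge> 1 \<Longrightarrow> prob_space (directions d)"
  unfolding directions_def by (intro prob_space_PiM prob_space_unif_sphere)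

lemma space_directions: "space (directions d) = {v. \<forall>t. v t \<in> sphere_Rd d}"
  by (auto simp: directions_def space_PiM space_unif_sphere)

lemma measurable_direction: "(\<lambda>v. v t) \<in> measurable (directions d) (unif_sphere d)"
  unfolding directions_def by (rule measurable_component_singleton) simp

lemma borel_measurable_unif_sphere_id: "(\<lambda>v. v) \<in> borel_measurable (unif_sphere d)"
  by (subst measurable_cong_sets[OF sets_unif_sphere refl]) (rule measurable_restrict_space1, simp)

lemma borel_measurable_direction: "(\<lambda>v. v t) \<in> borel_measurable (directions d)"
  by (rule measurable_compose[OF measurable_direction borel_measurable_unif_sphere_id])

text \<open>Independence in the form used below: replacing the direction of one round by a fresh one does
  not change the joint distribution.  Here \<open>t\<close> is already an index of the product, so
  inserting it leaves the index set unchanged.\<close>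

lemma directions_resample:
  assumes "d \<ge> 1"
  shows "distr (unif_sphere d \<Otimes>\<^sub>M directions d) (directions d) (\<lambda>(x, v). v(t := x)) = directions d"
  using distr_pair_PiM_eq_PiM[of UNIV "\<lambda>_. unif_sphere d" t] prob_space_unif_sphere[OF assms]
  unfolding directions_def by simp

lemma measurable_resample:
  "(\<lambda>(x, v). v(t := x)) \<in> measurable (unif_sphere d \<Otimes>\<^sub>M directions d) (directions d)"
proof -
  have "(\<lambda>p. (snd p)(t := fst p)) \<in> measurable (unif_sphere d \<Otimes>\<^sub>M directions d) (PiM UNIV (\<lambda>_. unif_sphere d))"
    by (rule measurable_fun_upd[where J = UNIV]) (auto simp: directions_def)
  then show ?thesis by (simp add: directions_def case_prod_unfold)
qed

text \<open>The vector \<open>g\<close> stands for a gradient computed before round \<open>t\<close>.  After resampling, the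
  direction can be integrated out first, with \<open>g\<close> held fixed.\<close>

lemma expectation_squared_projection:
  assumes d: "d \<ge> 1"
    and g: "g \<in> borel_measurable (directions d)"
    and g_Rd: "\<And>v. v \<in> space (directions d) \<Longrightarrow> g v \<in> Rd d"
    and bound: "\<And>v. v \<in> space (directions d) \<Longrightarrow> norm (g v) \<le> L"
    and indep: "\<And>v x. v \<in> space (directions d) \<Longrightarrow> x \<in> sphere_Rd d \<Longrightarrow> g (v(t := x)) = g v"
  shows "integrable (directions d) (\<lambda>v. (norm (g v))\<^sup>2)"
    and "integrable (directions d) (\<lambda>v. (inner (g v) (v t))\<^sup>2)"
    and "(\<integral>v. (inner (g v) (v t))\<^sup>2 \<partial>directions d) = (\<integral>v. (norm (g v))\<^sup>2 \<partial>directions d) / real d"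
proof -
  interpret D: prob_space "directions d" by (rule prob_space_directions[OF d])
  interpret S: prob_space "unif_sphere d" by (rule prob_space_unif_sphere[OF d])
  interpret P: pair_prob_space "unif_sphere d" "directions d" ..
  show "integrable (directions d) (\<lambda>v. (norm (g v))\<^sup>2)"
    using bound by (intro D.integrable_const_bound[of _ "L\<^sup>2"] borel_measurable_power
        measurable_compose[OF g borel_measurable_norm]) (auto intro!: power_mono)
  let ?F = "\<lambda>v. (inner (g v) (v t))\<^sup>2"
  have meas: "?F \<in> borel_measurable (directions d)"
    by (intro borel_measurable_power borel_measurable_inner g borel_measurable_direction)
  have F_le: "?F v \<le> L\<^sup>2" if "v \<in> space (directions d)" for v
  proof -
    have "\<bar>inner (g v) (v t)\<bar> \<le> norm (g v) * norm (v t)" by (rule Cauchy_Schwarz_ineq2)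
    also have "\<dots> = norm (g v)" using that by (simp add: space_directions sphere_Rd_def)
    also have "\<dots> \<le> L" by (rule bound[OF that])
    finally have "\<bar>inner (g v) (v t)\<bar>\<^sup>2 \<le> L\<^sup>2" by (intro power_mono) auto
    then show ?thesis by simp
  qed
  show "integrable (directions d) ?F"
    using F_le by (intro D.integrable_const_bound[of _ "L\<^sup>2"] meas) auto
  let ?R = "\<lambda>(x, v). v(t := x) :: nat \<Rightarrow> rseq"
  let ?F' = "\<lambda>(x, v). ?F (v(t := x))"
  have meas': "?F' \<in> borel_measurable (unif_sphere d \<Otimes>\<^sub>M directions d)"
    using measurable_compose[OF measurable_resample meas, of t] by (simp add: case_prod_unfold)
  have int': "integrable (unif_sphere d \<Otimes>\<^sub>M directions d) ?F'"
  proof (rule P.integrable_const_bound[of _ "L\<^sup>2"])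
    show "AE p in unif_sphere d \<Otimes>\<^sub>M directions d. norm (?F' p) \<le> L\<^sup>2"
    proof (rule AE_I2)
      fix p assume "p \<in> space (unif_sphere d \<Otimes>\<^sub>M directions d)"
      then have "(snd p)(t := fst p) \<in> space (directions d)"
        using measurable_space[OF measurable_resample[of t]] by (auto simp: case_prod_unfold)
      from F_le[OF this] show "norm (?F' p) \<le> L\<^sup>2" by (simp add: case_prod_unfold)
    qed
  qed (rule meas')
  have "(\<integral>v. ?F v \<partial>directions d) =
      (\<integral>v. ?F v \<partial>distr (unif_sphere d \<Otimes>\<^sub>M directions d) (directions d) ?R)"
    by (simp only: directions_resample[OF d])
  also have "\<dots> = (\<integral>p. ?F (?R p) \<partial>(unif_sphere d \<Otimes>\<^sub>M directions d))"
    by (rule integral_distr[OF measurable_resample meas])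
  also have "\<dots> = (\<integral>p. ?F' p \<partial>(unif_sphere d \<Otimes>\<^sub>M directions d))"
    by (simp add: case_prod_unfold)
  also have "\<dots> = (\<integral>v. (\<integral>x. ?F (v(t := x)) \<partial>unif_sphere d) \<partial>directions d)"
    using int' by (rule P.integral_snd[symmetric])
  also have "\<dots> = (\<integral>v. (norm (g v))\<^sup>2 / real d \<partial>directions d)"
  proof (intro Bochner_Integration.integral_cong refl)
    fix v assume v: "v \<in> space (directions d)"
    have "(\<integral>x. ?F (v(t := x)) \<partial>unif_sphere d) = (\<integral>x. (inner (g v) x)\<^sup>2 \<partial>unif_sphere d)"
      by (intro Bochner_Integration.integral_cong refl) (simp add: indep[OF v] space_unif_sphere)
    also have "\<dots> = (norm (g v))\<^sup>2 / real d" by (rule unif_sphere_isotropic[OF d g_Rd[OF v]])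
    finally show "(\<integral>x. ?F (v(t := x)) \<partial>unif_sphere d) = (norm (g v))\<^sup>2 / real d" .
  qed
  finally show "(\<integral>v. ?F v \<partial>directions d) = (\<integral>v. (norm (g v))\<^sup>2 \<partial>directions d) / real d"
    by simp
qed

section \<open>Sample paths of the two-loop algorithm\<close>

text \<open>All rates in the analysis are powers of one sequence: the perturbation radius is proportional to
  it, the step size to its square, and the squared step size to its fourth power.\<close>

definition decay :: "nat \<Rightarrow> real" where
  "decay t = (real t + 1) powr (-1/4)"

lemma abs_diff_le_add: "\<bar>a - b\<bar> \<le> e \<Longrightarrow> \<bar>b - c\<bar> \<le> e' \<Longrightarrow> \<bar>a - c\<bar> \<le> e + e'" for a b c :: real
  by linarith

lemma decay_pos [simp]: "decay t > 0"
  by (simp add: decay_def)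

lemma decay_nonzero [simp]: "decay t \<noteq> 0"
  using decay_pos[of t] by linarith

lemma decay_le_1: "decay t \<le> 1"
  using powr_mono2'[of "-1/4" 1 "real t + 1"] by (simp add: decay_def)

lemma decay_power2: "(decay t)\<^sup>2 = (real t + 1) powr (-1/2)"
  by (simp add: decay_def power2_eq_square powr_add[symmetric])

lemma decay_power4: "(decay t) ^ 4 = 1 / (real t + 1)"
proof -
  have "(decay t) ^ 4 = (decay t)\<^sup>2 * (decay t)\<^sup>2" by (simp add: power2_eq_square eval_nat_numeral)
  also have "\<dots> = (real t + 1) powr (-1)" unfolding decay_power2 by (simp add: powr_add[symmetric])
  also have "\<dots> = 1 / (real t + 1)" by (simp add: powr_minus_divide)
  finally show ?thesis .
qed

text \<open>Needed when an error bound is carried over to the next round.\<close>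

lemma decay_Suc: "decay t \<le> 2 * decay (Suc t)"
proof (rule power_le_imp_le_base)
  have "(decay t) ^ Suc 3 = 1 / (real t + 1)" using decay_power4[of t] by simp
  also have "\<dots> \<le> 16 / (real t + 2)" by (simp add: field_simps)
  also have "\<dots> = (2 * decay (Suc t)) ^ Suc 3"
    using decay_power4[of "Suc t"] by (simp add: power_mult_distrib add.commute)
  finally show "(decay t) ^ Suc 3 \<le> (2 * decay (Suc t)) ^ Suc 3" .
qed (simp add: less_imp_le)

lemma step_size_eq: "d \<ge> 1 \<Longrightarrow> step_size etab d t = etab * (decay t)\<^sup>2 / real d"
  by (simp add: step_size_def decay_power2 powr_minus_divide)

lemma perturb_radius_eq: "d \<ge> 1 \<Longrightarrow> perturb_radius deltab d t = deltab * decay t / sqrt (real d)"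
  by (simp add: perturb_radius_def decay_def powr_minus_divide powr_half_sqrt[symmetric])

lemma sum_inverse_le_ln: "T \<ge> 1 \<Longrightarrow> (\<Sum>t<T. 1 / (real t + 1)) \<le> 1 + ln (real T)"
proof (induction T rule: dec_induct)
  case (step n)
  have "ln (real n / (real n + 1)) \<le> real n / (real n + 1) - 1"
    using step.hyps by (intro ln_le_minus_one) auto
  moreover have "ln (real n / (real n + 1)) = ln (real n) - ln (real n + 1)"
    using step.hyps by (subst ln_div) auto
  moreover have "real n / (real n + 1) - 1 = - (1 / (real n + 1))" by (simp add: field_simps)
  ultimately show ?case using step.IH by (simp add: add.commute)
qed simp

lemma two_loop_cong:
  "(\<And>s. s < t \<Longrightarrow> v s = v' s) \<Longrightarrow>
    two_loop d f H K \<eta> \<delta> x0 y0 yt0 v t = two_loop d f H K \<eta> \<delta> x0 y0 yt0 v' t"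
  by (induction t) auto

text \<open>The constants of the analysis.  They bound, in this order, the leader's displacement, the follower
  error, the bias of the slope, and the part of the descent error that is summed to a logarithm.  They
  take only dimension-free arguments, since they end up in the constant of the rate.\<close>

definition move_const :: "real \<Rightarrow> real \<Rightarrow> real \<Rightarrow> real \<Rightarrow> real \<Rightarrow> real" where
  "move_const Ly Lt etab deltab D = etab * (Lt + 2 * Ly * D / deltab)"

definition err_const :: "real \<Rightarrow> real \<Rightarrow> real \<Rightarrow> real \<Rightarrow> real \<Rightarrow> real \<Rightarrow> real" where
  "err_const Ly LS Lt etab deltab D = D + 4 * (LS * move_const Ly Lt etab deltab D)"

definition bias_const :: "real \<Rightarrow> real \<Rightarrow> real \<Rightarrow> real \<Rightarrow> real \<Rightarrow> real \<Rightarrow> real" where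
  "bias_const Ly LS Lt etab deltab D =
     Ly * (2 * err_const Ly LS Lt etab deltab D + LS * deltab) / deltab"

definition noise_const :: "real \<Rightarrow> real \<Rightarrow> real \<Rightarrow> real \<Rightarrow> real \<Rightarrow> real \<Rightarrow> real \<Rightarrow> real" where
  "noise_const Ly LS Lt lt etab deltab D =
     etab * lt\<^sup>2 * deltab\<^sup>2 + lt * etab\<^sup>2 * (Lt + bias_const Ly LS Lt etab deltab D)\<^sup>2"

text \<open>A run in the regime of small \<open>\<alpha> d\<^sup>3\<close>.  The number \<open>\<beta>\<close> abstracts from the two alternatives for the
  follower updates: it is the contraction factor of one call.  The bound by \<open>1 / 4\<close> outweighs the
  factor \<open>2\<close> by which \<open>decay\<close> may shrink in one round, so the follower errors keep pace with it, and the
  bound with \<open>d sqrt d\<close> keeps the bias below a dimension-free constant.\<close>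

locale two_loop_run =
  fixes d :: nat and Y :: "'b::euclidean_space set" and f :: "rseq \<times> 'b \<Rightarrow> real"
    and G :: "rseq \<times> 'b \<Rightarrow> 'b" and H :: "nat \<Rightarrow> 'b \<Rightarrow> rseq \<Rightarrow> 'b" and K :: nat
    and x0 :: rseq and y0 yt0 :: 'b
    and Lx Ly ly LS Lt lt etab deltab D \<beta> :: real
  assumes d: "d \<ge> 1"
    and etab: "etab > 0" and deltab: "deltab > 0"
    and game: "stackelberg_game d Y f G"
    and updates: "update_maps d Y H"
    and x0: "x0 \<in> Rd d" and y0: "y0 \<in> Y" and yt0: "yt0 \<in> Y"
    and conditions: "lipschitz_smooth_conditions d Y f G Lx Ly ly LS Lt lt"
    and contraction: "\<And>x y. x \<in> Rd d \<Longrightarrow> y \<in> Y \<Longrightarrow>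
      norm (follower H K y x - response Y G x) \<le> \<beta> * norm (y - response Y G x)"
    and \<beta>_nonneg: "0 \<le> \<beta>" and \<beta>_quarter: "\<beta> \<le> 1 / 4"
    and \<beta>_dim: "\<beta> * (real d * sqrt (real d)) \<le> 1"
    and diam: "diameter Y \<le> D"
begin

abbreviation "S \<equiv> response Y G"
abbreviation "F \<equiv> hyper_obj Y G f"
abbreviation "\<eta> \<equiv> step_size etab d"
abbreviation "\<delta> \<equiv> perturb_radius deltab d"
abbreviation "state v t \<equiv> two_loop d f H K \<eta> \<delta> x0 y0 yt0 v t"
abbreviation "X v t \<equiv> x_iter d f H K \<eta> \<delta> x0 y0 yt0 v t"

text \<open>The initializations \<open>y\<^sub>t\<^sup>(\<^sup>0\<^sup>)\<close> and \<open>y~\<^sub>t\<^sup>(\<^sup>0\<^sup>)\<close> of the two follower loops.\<close>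

definition init_hat :: "(nat \<Rightarrow> rseq) \<Rightarrow> nat \<Rightarrow> 'b" where "init_hat v t = fst (snd (state v t))"
definition init_tilde :: "(nat \<Rightarrow> rseq) \<Rightarrow> nat \<Rightarrow> 'b" where "init_tilde v t = snd (snd (state v t))"

definition X_hat :: "(nat \<Rightarrow> rseq) \<Rightarrow> nat \<Rightarrow> rseq" where "X_hat v t = X v t + \<delta> t *\<^sub>R v t"

text \<open>The finite-difference slope, including the factor \<open>d\<close>, so that a step is
  \<open>- \<eta>\<^sub>t\<close> times the slope along \<open>v\<^sub>t\<close>.\<close>

definition slope :: "(nat \<Rightarrow> rseq) \<Rightarrow> nat \<Rightarrow> real" where
  "slope v t = real d / \<delta> t *
    (f (X_hat v t, follower H K (init_hat v t) (X_hat v t)) - f (X v t, follower H K (init_tilde v t) (X v t)))"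

definition err :: "(nat \<Rightarrow> rseq) \<Rightarrow> nat \<Rightarrow> real" where
  "err v t = norm (follower H K (init_tilde v t) (X v t) - S (X v t))"

definition err_hat :: "(nat \<Rightarrow> rseq) \<Rightarrow> nat \<Rightarrow> real" where
  "err_hat v t = norm (follower H K (init_hat v t) (X_hat v t) - S (X_hat v t))"

lemma iter_0: "X v 0 = x0" "init_hat v 0 = y0" "init_tilde v 0 = yt0"
  by (simp_all add: x_iter_def init_hat_def init_tilde_def)

lemma iter_Suc:
  "X v (Suc t) = X v t - (\<eta> t * slope v t) *\<^sub>R v t"
  "init_hat v (Suc t) = follower H K (init_tilde v t) (X v t)"
  "init_tilde v (Suc t) = follower H K (init_tilde v t) (X v t)"
  by (simp_all add: x_iter_def init_hat_def init_tilde_def slope_def X_hat_def case_prod_unfold Let_def mult.assoc)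

lemma cond:
  "x \<in> Rd d \<Longrightarrow> Ly-lipschitz_on Y (\<lambda>y. f (x, y))"
  "x \<in> Rd d \<Longrightarrow> is_singleton (VI_sol Y G x)"
  "LS-lipschitz_on (Rd d) S" "C2_on (Rd d) F" "Lt-lipschitz_on (Rd d) F"
  "lt-lipschitz_on (Rd d) (grad d F)"
  using conditions by (auto simp: lipschitz_smooth_conditions_def)

lemma const_nonneg: "0 \<le> Ly" "0 \<le> LS" "0 \<le> Lt" "0 \<le> lt"
  using cond(1)[OF x0] cond(3,5,6) by (auto dest: lipschitz_on_nonneg)

lemma S_in_Y: "x \<in> Rd d \<Longrightarrow> S x \<in> Y"
  using cond(2)[of x] unfolding response_def is_singleton_the_elem VI_sol_def by blast

lemma follower_in_Y: "y \<in> Y \<Longrightarrow> x \<in> Rd d \<Longrightarrow> follower H k y x \<in> Y"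
  using updates by (induction k) (auto simp: update_maps_def)

lemma dist_Y: "y \<in> Y \<Longrightarrow> y' \<in> Y \<Longrightarrow> norm (y - y') \<le> D"
  using diameter_bounded_bound[of Y y y'] game diam
  by (simp add: stackelberg_game_def compact_imp_bounded dist_norm)

lemma D_nonneg: "0 \<le> D" using dist_Y[OF y0 y0] by simp

lemma \<eta>_eq: "\<eta> t = etab * (decay t)\<^sup>2 / real d" by (rule step_size_eq[OF d])
lemma \<delta>_eq: "\<delta> t = deltab * decay t / sqrt (real d)" by (rule perturb_radius_eq[OF d])
lemma \<eta>_pos: "\<eta> t > 0"
  unfolding \<eta>_eq using etab d by (intro divide_pos_pos mult_pos_pos zero_less_power) auto
lemma \<delta>_pos: "\<delta> t > 0"
  unfolding \<delta>_eq using deltab d by (intro divide_pos_pos mult_pos_pos) auto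

lemma \<delta>_le: "\<delta> t \<le> deltab * decay t"
  unfolding \<delta>_eq using deltab d by (simp add: divide_le_eq less_imp_le mult_left_le real_le_lsqrt)

lemma d_div_\<delta>: "real d / \<delta> t = real d * sqrt (real d) / (deltab * decay t)"
  by (simp add: \<delta>_eq)

context
  fixes v assumes v: "v \<in> space (directions d)"
begin

lemma v_Rd: "v t \<in> Rd d" and v_norm: "norm (v t) = 1"
  using v by (auto simp: space_directions sphere_Rd_def)

lemma iter_in: "X v t \<in> Rd d \<and> init_hat v t \<in> Y \<and> init_tilde v t \<in> Y"
  by (induction t) (auto simp: iter_0 iter_Suc x0 y0 yt0 v_Rd follower_in_Y
      intro!: subspace_diff[OF subspace_Rd] subspace_scale[OF subspace_Rd])

lemma X_hat_in: "X_hat v t \<in> Rd d"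
  unfolding X_hat_def using iter_in v_Rd
  by (intro subspace_add[OF subspace_Rd] subspace_scale[OF subspace_Rd]) auto

lemma norm_X_hat: "norm (X_hat v t - X v t) = \<delta> t"
  using \<delta>_pos[of t] by (simp add: X_hat_def v_norm)

lemma slope_error:
  "\<bar>slope v t - real d / \<delta> t * (F (X_hat v t) - F (X v t))\<bar> \<le> real d / \<delta> t * (Ly * (err v t + err_hat v t))"
proof -
  have 1: "\<bar>f (x, follower H K y x) - F x\<bar> \<le> Ly * norm (follower H K y x - S x)"
    if "x \<in> Rd d" "y \<in> Y" for x y
    using lipschitz_onD[OF cond(1)[OF that(1)] follower_in_Y[OF that(2,1)] S_in_Y[OF that(1)]]
    by (simp add: hyper_obj_def dist_norm)
  define a where "a = f (X_hat v t, follower H K (init_hat v t) (X_hat v t)) - F (X_hat v t)"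
  define b where "b = f (X v t, follower H K (init_tilde v t) (X v t)) - F (X v t)"
  have ab: "\<bar>a\<bar> \<le> Ly * err_hat v t" "\<bar>b\<bar> \<le> Ly * err v t"
    unfolding a_def b_def err_def err_hat_def using iter_in[of t] by (auto intro!: 1 X_hat_in)
  have eq: "slope v t - real d / \<delta> t * (F (X_hat v t) - F (X v t)) = real d / \<delta> t * (a - b)"
    unfolding slope_def a_def b_def by (simp only: right_diff_distrib)
  have "\<bar>a - b\<bar> \<le> Ly * (err v t + err_hat v t)"
    using ab by (simp add: distrib_left)
  then have "real d / \<delta> t * \<bar>a - b\<bar> \<le> real d / \<delta> t * (Ly * (err v t + err_hat v t))"
    using \<delta>_pos[of t] by (intro mult_left_mono) auto
  then show ?thesis
    unfolding eq abs_mult using \<delta>_pos[of t] by simp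
qed

lemma abs_slope_le: "\<bar>slope v t\<bar> \<le> real d * Lt + real d / \<delta> t * (Ly * (err v t + err_hat v t))"
proof -
  have "\<bar>F (X_hat v t) - F (X v t)\<bar> \<le> Lt * \<delta> t"
    using lipschitz_onD[OF cond(5) X_hat_in[of t], of "X v t"] iter_in[of t] norm_X_hat[of t]
    by (simp add: dist_norm)
  then have "\<bar>real d / \<delta> t * (F (X_hat v t) - F (X v t))\<bar> \<le> real d / \<delta> t * (Lt * \<delta> t)"
    unfolding abs_mult using \<delta>_pos[of t] by (intro mult_mono) auto
  also have "\<dots> = real d * Lt" using \<delta>_pos[of t] by simp
  finally have "\<bar>real d / \<delta> t * (F (X_hat v t) - F (X v t))\<bar> \<le> real d * Lt" .
  then show ?thesis
    using abs_diff_le_add[OF slope_error[of t], of 0 "real d * Lt"] by (simp add: add.commute)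
qed

lemma err_le_D: "err v t \<le> \<beta> * D" "err_hat v t \<le> \<beta> * D"
proof -
  have "err v t \<le> \<beta> * norm (init_tilde v t - S (X v t))"
    unfolding err_def using iter_in[of t] by (intro contraction) auto
  also have "\<dots> \<le> \<beta> * D" using iter_in[of t] by (intro mult_left_mono dist_Y S_in_Y \<beta>_nonneg) auto
  finally show "err v t \<le> \<beta> * D" .
  have "err_hat v t \<le> \<beta> * norm (init_hat v t - S (X_hat v t))"
    unfolding err_hat_def using iter_in[of t] X_hat_in by (intro contraction) auto
  also have "\<dots> \<le> \<beta> * D" using iter_in[of t] X_hat_in by (intro mult_left_mono dist_Y S_in_Y \<beta>_nonneg) auto
  finally show "err_hat v t \<le> \<beta> * D" .
qed

end

abbreviation "c_move \<equiv> move_const Ly Lt etab deltab D"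
abbreviation "c_err \<equiv> err_const Ly LS Lt etab deltab D"
abbreviation "c_noise \<equiv> noise_const Ly LS Lt lt etab deltab D"
abbreviation "c_bias \<equiv> bias_const Ly LS Lt etab deltab D"

lemma c_nonneg: "0 \<le> c_move" "0 \<le> c_err" "0 \<le> c_bias"
  using const_nonneg D_nonneg etab deltab unfolding bias_const_def err_const_def move_const_def
  by (auto intro!: add_nonneg_nonneg mult_nonneg_nonneg divide_nonneg_nonneg)

context
  fixes v assumes v: "v \<in> space (directions d)"
begin

text \<open>A first, crude estimate that breaks the circularity between leader and followers: bounding
  the follower errors by the diameter of \<open>Y\<close> already shows that the leader moves by at most a
  multiple of \<open>decay\<close>, because the growth of \<open>d / \<delta>\<^sub>t\<close> eats only one of the two factors \<open>decay\<close> in the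
  step size.\<close>

lemma movement: "norm (X v (Suc t) - X v t) \<le> c_move * decay t"
proof -
  have "real d / \<delta> t * (Ly * (err v t + err_hat v t)) \<le> real d / \<delta> t * (Ly * (2 * (\<beta> * D)))"
    using err_le_D[OF v, of t] const_nonneg \<delta>_pos[of t] by (intro mult_left_mono) auto
  also have "\<dots> = (2 * Ly * D) * (\<beta> * (real d * sqrt (real d))) / (deltab * decay t)"
    unfolding d_div_\<delta> by simp
  also have "\<dots> \<le> (2 * Ly * D) / (deltab * decay t)"
    using \<beta>_dim const_nonneg D_nonneg deltab
    by (intro divide_right_mono mult_left_le) (auto simp: less_imp_le)
  finally have s: "\<bar>slope v t\<bar> \<le> real d * Lt + (2 * Ly * D) / (deltab * decay t)"
    using abs_slope_le[OF v, of t] by linarith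
  have "norm (X v (Suc t) - X v t) = \<eta> t * \<bar>slope v t\<bar>"
    using \<eta>_pos[of t] by (simp add: iter_Suc v_norm[OF v] abs_mult)
  also have "\<dots> \<le> \<eta> t * (real d * Lt + (2 * Ly * D) / (deltab * decay t))"
    using s \<eta>_pos[of t] by (intro mult_left_mono) auto
  also have "\<dots> = etab * Lt * (decay t * decay t) + etab * (2 * Ly * D / deltab) * decay t * (1 / real d)"
    using d deltab decay_pos[of t] unfolding \<eta>_eq by (simp add: field_simps power2_eq_square)
  also have "\<dots> \<le> etab * Lt * (decay t * 1) + etab * (2 * Ly * D / deltab) * decay t * 1"
    using d etab deltab const_nonneg D_nonneg decay_le_1[of t]
    by (intro add_mono mult_left_mono) (auto simp: less_imp_le)
  also have "\<dots> = c_move * decay t" by (simp add: move_const_def algebra_simps)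
  finally show ?thesis .
qed

text \<open>Warm starting: the initial error of a round is the final error of the previous round plus the drift
  of the equilibrium, both of order \<open>decay\<close>, and the call contracts it by \<open>\<beta>\<close>.\<close>

lemma err_le: "err v t \<le> c_err * \<beta> * decay t"
proof (induction t)
  case 0
  have "err v 0 \<le> D * \<beta>" using err_le_D(1)[OF v, of 0] by (simp add: mult.commute)
  also have "\<dots> \<le> c_err * \<beta>"
    using const_nonneg c_nonneg \<beta>_nonneg by (intro mult_right_mono) (auto simp: err_const_def)
  finally show ?case by (simp add: decay_def)
next
  case (Suc t)
  have "err v (Suc t) \<le> \<beta> * norm (init_tilde v (Suc t) - S (X v (Suc t)))"
    unfolding err_def using iter_in[OF v] by (intro contraction) auto
  also have "\<dots> \<le> \<beta> * (err v t + LS * norm (X v (Suc t) - X v t))"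
  proof (rule mult_left_mono[OF _ \<beta>_nonneg])
    have "norm (S (X v t) - S (X v (Suc t))) \<le> LS * norm (X v (Suc t) - X v t)"
      using lipschitz_onD[OF cond(3), of "X v t" "X v (Suc t)"] iter_in[OF v]
      by (simp add: dist_norm norm_minus_commute)
    then show "norm (init_tilde v (Suc t) - S (X v (Suc t))) \<le> err v t + LS * norm (X v (Suc t) - X v t)"
      unfolding err_def iter_Suc(3) by (rule norm_diff_triangle_le[OF order_refl])
  qed
  also have "\<dots> \<le> \<beta> * (c_err / 4 * decay t + LS * (c_move * decay t))"
  proof (intro mult_left_mono[OF _ \<beta>_nonneg] add_mono mult_left_mono movement const_nonneg)
    have "c_err * \<beta> * decay t \<le> c_err * (1 / 4) * decay t"
      using c_nonneg \<beta>_quarter by (intro mult_right_mono mult_left_mono) (auto simp: less_imp_le)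
    then show "err v t \<le> c_err / 4 * decay t" using Suc.IH by simp
  qed
  also have "\<dots> = \<beta> * ((c_err / 4 + LS * c_move) * decay t)" by (simp add: algebra_simps)
  \<comment> \<open>\<open>c_err\<close> contains \<open>4 * (LS * c_move)\<close>, so old error and drift each contribute at most \<open>c_err / 4\<close>.\<close>
  also have "\<dots> \<le> \<beta> * ((c_err / 2) * (2 * decay (Suc t)))"
    using D_nonneg c_nonneg \<beta>_nonneg decay_Suc[of t]
    by (intro mult_left_mono mult_mono) (auto simp: err_const_def less_imp_le)
  finally show ?case by (simp add: mult_ac)
qed

text \<open>The loop at the perturbed point starts from the same initialization; the perturbation
  radius adds to the drift.  In round \<open>0\<close> the initialization is arbitrary, and only the diameter of \<open>Y\<close>
  is available.\<close>

lemma err_hat_le: "err_hat v t \<le> (c_err + LS * deltab) * \<beta> * decay t"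
proof (cases t)
  case 0
  have "err_hat v 0 \<le> D * \<beta>" using err_le_D(2)[OF v, of 0] by (simp add: mult.commute)
  also have "\<dots> \<le> (c_err + LS * deltab) * \<beta>"
    using const_nonneg c_nonneg \<beta>_nonneg deltab by (intro mult_right_mono) (auto simp: err_const_def)
  finally show ?thesis using 0 by (simp add: decay_def)
next
  case (Suc s)
  have "err_hat v (Suc s) \<le> \<beta> * norm (init_hat v (Suc s) - S (X_hat v (Suc s)))"
    unfolding err_hat_def using iter_in[OF v] X_hat_in[OF v] by (intro contraction) auto
  also have "\<dots> \<le> \<beta> * (err v s + LS * (norm (X v (Suc s) - X v s) + \<delta> (Suc s)))"
  proof (rule mult_left_mono[OF _ \<beta>_nonneg])
    have "norm (S (X v s) - S (X_hat v (Suc s))) \<le> LS * norm (X_hat v (Suc s) - X v s)"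
      using lipschitz_onD[OF cond(3), of "X v s" "X_hat v (Suc s)"] iter_in[OF v] X_hat_in[OF v]
      by (simp add: dist_norm norm_minus_commute)
    also have "\<dots> \<le> LS * (norm (X v (Suc s) - X v s) + \<delta> (Suc s))"
      using norm_triangle_ineq[of "X_hat v (Suc s) - X v (Suc s)" "X v (Suc s) - X v s"]
        norm_X_hat[OF v, of "Suc s"] const_nonneg by (intro mult_left_mono) auto
    finally show "norm (init_hat v (Suc s) - S (X_hat v (Suc s))) \<le>
        err v s + LS * (norm (X v (Suc s) - X v s) + \<delta> (Suc s))"
      unfolding err_def iter_Suc(2) by (rule norm_diff_triangle_le[OF order_refl])
  qed
  also have "\<dots> \<le> \<beta> * (c_err / 4 * decay s + LS * (c_move * decay s + deltab * decay (Suc s)))"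
  proof (intro mult_left_mono[OF _ \<beta>_nonneg] add_mono mult_left_mono movement const_nonneg \<delta>_le)
    have "c_err * \<beta> * decay s \<le> c_err * (1 / 4) * decay s"
      using c_nonneg \<beta>_quarter by (intro mult_right_mono mult_left_mono) (auto simp: less_imp_le)
    then show "err v s \<le> c_err / 4 * decay s" using err_le[of s] by simp
  qed
  also have "\<dots> = \<beta> * ((c_err / 4 + LS * c_move) * decay s + LS * deltab * decay (Suc s))"
    by (simp add: algebra_simps)
  also have "\<dots> \<le> \<beta> * ((c_err / 2) * (2 * decay (Suc s)) + LS * deltab * decay (Suc s))"
    using D_nonneg c_nonneg \<beta>_nonneg decay_Suc[of s]
    by (intro mult_left_mono add_mono mult_mono order_refl) (auto simp: err_const_def less_imp_le)
  finally show ?thesis using Suc by (simp add: algebra_simps)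
qed

text \<open>The factor \<open>decay\<close> in the follower errors cancels against the one in \<open>\<delta>\<^sub>t\<close>, so the bias does not
  grow with \<open>t\<close>.\<close>

lemma bias: "real d / \<delta> t * (Ly * (err v t + err_hat v t)) \<le> c_bias * (\<beta> * (real d * sqrt (real d)))"
proof -
  have "real d / \<delta> t * (Ly * (err v t + err_hat v t)) \<le>
      real d / \<delta> t * (Ly * (c_err * \<beta> * decay t + (c_err + LS * deltab) * \<beta> * decay t))"
    using err_le[of t] err_hat_le[of t] const_nonneg \<delta>_pos[of t]
    by (intro mult_left_mono add_mono) auto
  also have "\<dots> = c_bias * (\<beta> * (real d * sqrt (real d)))"
    unfolding d_div_\<delta> bias_const_def using deltab decay_pos[of t]
    by (simp add: field_simps)
  finally show ?thesis .
qed

text \<open>The descent inequality holds on every sample path.  Its left-hand side contains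
  the squared directional derivative; only after taking expectations does \<open>d\<close> times this square become
  the squared gradient norm, of which half is spent on absorbing the cross term with the slope error.\<close>

lemma descent:
  defines "g t \<equiv> grad d F (X v t)"
  shows "\<eta> t * (real d * (inner (g t) (v t))\<^sup>2 - (norm (g t))\<^sup>2 / 2) \<le> F (X v t) - F (X v (Suc t))
    + (etab * c_bias\<^sup>2 * \<beta>\<^sup>2 * (real d)\<^sup>2 * (decay t)\<^sup>2
       + c_noise * (decay t) ^ 4)"
proof -
  define p where "p = inner (g t) (v t)"
  define b where "b = c_bias * (\<beta> * (real d * sqrt (real d)))"
  define R where "R = b + lt * deltab * sqrt (real d) * decay t"
  have Xin: "X v t \<in> Rd d" using iter_in[OF v] by blast
  have "\<bar>F (X_hat v t) - F (X v t) - \<delta> t * p\<bar> \<le> lt * (\<delta> t)\<^sup>2"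
    using smooth_linearization_error[OF cond(4,6) Xin, of "\<delta> t *\<^sub>R v t"] v_Rd[OF v] v_norm[OF v] \<delta>_pos[of t]
    by (simp add: X_hat_def g_def p_def subspace_scale[OF subspace_Rd] power_mult_distrib)
  then have "real d / \<delta> t * \<bar>F (X_hat v t) - F (X v t) - \<delta> t * p\<bar> \<le> real d / \<delta> t * (lt * (\<delta> t)\<^sup>2)"
    using \<delta>_pos[of t] by (intro mult_left_mono) auto
  also have "real d / \<delta> t * (lt * (\<delta> t)\<^sup>2) = lt * (real d * \<delta> t)"
    using \<delta>_pos[of t] by (simp add: power2_eq_square)
  also have "\<dots> = lt * deltab * sqrt (real d) * decay t"
  proof -
    have "real d * \<delta> t = real d / sqrt (real d) * (deltab * decay t)" by (simp add: \<delta>_eq)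
    also have "real d / sqrt (real d) = sqrt (real d)" by (rule real_div_sqrt) simp
    finally show ?thesis by simp
  qed
  also have "real d / \<delta> t * \<bar>F (X_hat v t) - F (X v t) - \<delta> t * p\<bar>
      = \<bar>real d / \<delta> t * (F (X_hat v t) - F (X v t) - \<delta> t * p)\<bar>"
    using \<delta>_pos[of t] by (simp add: abs_mult)
  also have "real d / \<delta> t * (F (X_hat v t) - F (X v t) - \<delta> t * p) =
      real d / \<delta> t * (F (X_hat v t) - F (X v t)) - real d * p"
    using \<delta>_pos[of t] by (simp add: field_simps)
  finally have R: "\<bar>slope v t - real d * p\<bar> \<le> R"
    unfolding R_def b_def by (rule abs_diff_le_add[OF order_trans[OF slope_error[OF v] bias]])
  have p_le: "\<bar>p\<bar> \<le> norm (g t)"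
    using Cauchy_Schwarz_ineq2[of "g t" "v t"] v_norm[OF v] by (simp add: p_def)
  have b: "0 \<le> b" "b \<le> c_bias"
    using c_nonneg \<beta>_nonneg \<beta>_dim unfolding b_def by (auto intro: mult_left_le)
  have "\<bar>slope v t\<bar> \<le> real d * Lt + b" using abs_slope_le[OF v, of t] bias[of t] by (simp add: b_def)
  also have "\<dots> \<le> real d * Lt + real d * c_bias"
    using b d c_nonneg mult_right_mono[of 1 "real d" c_bias] by simp
  finally have "\<bar>slope v t\<bar> \<le> real d * (Lt + c_bias)" by (simp add: distrib_left)
  then have slope2: "(slope v t)\<^sup>2 \<le> (real d * (Lt + c_bias))\<^sup>2"
    by (metis abs_ge_zero power2_abs power_mono)
  \<comment> \<open>\<open>p\<close> is the derivative along \<open>v t\<close>, \<open>b\<close> the bias bound and \<open>R\<close> the total error of the slope.\<close>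
  have step: "F (X v (Suc t)) \<le> F (X v t) - \<eta> t * slope v t * p + lt * (\<eta> t * slope v t)\<^sup>2"
    using smooth_linearization_error[OF cond(4,6) Xin, of "(- (\<eta> t * slope v t)) *\<^sub>R v t"] v_Rd[OF v] v_norm[OF v]
    by (simp add: iter_Suc g_def p_def subspace_scale[OF subspace_Rd] subspace_neg[OF subspace_Rd]
        power_mult_distrib abs_le_iff)
  have projection: "\<eta> t * (real d * p\<^sup>2 - (norm (g t))\<^sup>2 / 2) \<le> \<eta> t * (slope v t * p + R\<^sup>2 / 2)"
  proof (rule mult_left_mono)
    have "real d * p\<^sup>2 - slope v t * p = (real d * p - slope v t) * p" by (simp add: algebra_simps power2_eq_square)
    also have "\<dots> \<le> R * norm (g t)"
    proof -
      have "\<bar>(real d * p - slope v t) * p\<bar> \<le> R * norm (g t)"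
        unfolding abs_mult using R p_le by (intro mult_mono) auto
      then show ?thesis by linarith
    qed
    also have "\<dots> \<le> R\<^sup>2 / 2 + (norm (g t))\<^sup>2 / 2"
      using sum_squares_bound[of R "norm (g t)"] by simp
    finally show "real d * p\<^sup>2 - (norm (g t))\<^sup>2 / 2 \<le> slope v t * p + R\<^sup>2 / 2" by simp
  qed (use \<eta>_pos[of t] in simp)
  have remainder: "\<eta> t * (R\<^sup>2 / 2) \<le> etab * c_bias\<^sup>2 * \<beta>\<^sup>2 * (real d)\<^sup>2 * (decay t)\<^sup>2
      + etab * lt\<^sup>2 * deltab\<^sup>2 * (decay t) ^ 4"
  proof -
    have "R\<^sup>2 / 2 \<le> b\<^sup>2 + (lt * deltab * sqrt (real d) * decay t)\<^sup>2"
      using sum_squares_bound[of b "lt * deltab * sqrt (real d) * decay t"]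
      unfolding R_def by (simp add: power2_sum)
    also have "\<dots> = c_bias\<^sup>2 * \<beta>\<^sup>2 * (real d) ^ 3 + lt\<^sup>2 * deltab\<^sup>2 * real d * (decay t)\<^sup>2"
    proof -
      have "(real d) ^ 3 = (real d)\<^sup>2 * real d" by (simp add: power2_eq_square power3_eq_cube)
      then show ?thesis unfolding b_def by (simp add: power_mult_distrib mult_ac)
    qed
    finally have "\<eta> t * (R\<^sup>2 / 2) \<le>
        \<eta> t * (c_bias\<^sup>2 * \<beta>\<^sup>2 * (real d) ^ 3 + lt\<^sup>2 * deltab\<^sup>2 * real d * (decay t)\<^sup>2)"
      using \<eta>_pos[of t] by (intro mult_left_mono) auto
    also have "\<dots> = etab * c_bias\<^sup>2 * \<beta>\<^sup>2 * (real d)\<^sup>2 * (decay t)\<^sup>2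
      + etab * lt\<^sup>2 * deltab\<^sup>2 * (decay t) ^ 4"
      unfolding \<eta>_eq using d
      by (simp add: distrib_left add_divide_distrib power2_eq_square power3_eq_cube eval_nat_numeral)
    finally show ?thesis .
  qed
  have curvature: "lt * (\<eta> t * slope v t)\<^sup>2 \<le> lt * etab\<^sup>2 * (Lt + c_bias)\<^sup>2 * (decay t) ^ 4"
  proof -
    have "lt * (\<eta> t * slope v t)\<^sup>2 = lt * (\<eta> t)\<^sup>2 * (slope v t)\<^sup>2" by (simp add: power_mult_distrib)
    also have "\<dots> \<le> lt * (\<eta> t)\<^sup>2 * (real d * (Lt + c_bias))\<^sup>2"
      using slope2 const_nonneg by (intro mult_left_mono) auto
    also have "\<dots> = lt * (\<eta> t * (real d * (Lt + c_bias)))\<^sup>2" by (simp add: power_mult_distrib)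
    also have "\<eta> t * (real d * (Lt + c_bias)) = etab * (decay t)\<^sup>2 * (Lt + c_bias)"
      unfolding \<eta>_eq using d by simp
    also have "lt * (etab * (decay t)\<^sup>2 * (Lt + c_bias))\<^sup>2 = lt * etab\<^sup>2 * (Lt + c_bias)\<^sup>2 * (decay t) ^ 4"
      by (simp add: power_mult_distrib)
    finally show ?thesis .
  qed
  have noise: "c_noise * (decay t) ^ 4 = etab * lt\<^sup>2 * deltab\<^sup>2 * (decay t) ^ 4
      + lt * etab\<^sup>2 * (Lt + c_bias)\<^sup>2 * (decay t) ^ 4"
    by (simp only: noise_const_def distrib_right)
  have split: "\<eta> t * (slope v t * p + R\<^sup>2 / 2) = \<eta> t * slope v t * p + \<eta> t * (R\<^sup>2 / 2)"
    by (simp only: distrib_left mult.assoc)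
  have combine: "l \<le> F0 - F1 + (k1 + n)"
    if "F1 \<le> F0 - a + e" "l \<le> q" "q = a + r" "r \<le> k1 + k2" "e \<le> k3" "n = k2 + k3"
    for l F0 F1 a e q r k1 k2 k3 n :: real
    using that by linarith
  show ?thesis
    unfolding p_def[symmetric] by (rule combine[OF step projection split remainder curvature noise])
qed

end

section \<open>Expected gradient norms along the run\<close>

lemma x_in_space: "v \<in> space (directions d) \<Longrightarrow> X v t \<in> Rd d"
  using iter_in by blast

lemma borel_measurable_f_comp:
  assumes "a \<in> borel_measurable (directions d)" "b \<in> borel_measurable (directions d)"
    and "\<And>v. v \<in> space (directions d) \<Longrightarrow> a v \<in> Rd d \<and> b v \<in> Y"
  shows "(\<lambda>v. f (a v, b v)) \<in> borel_measurable (directions d)"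
proof -
  obtain f' where "\<And>z. z \<in> Rd d \<times> Y \<Longrightarrow> (f has_derivative blinfun_apply (f' z)) (at z within Rd d \<times> Y)"
    using game unfolding stackelberg_game_def C2_on_def by metis
  then have "continuous_on (Rd d \<times> Y) f" by (rule has_derivative_continuous_on)
  then have f: "f \<in> borel_measurable (restrict_space borel (Rd d \<times> Y))"
    by (rule borel_measurable_continuous_on_restrict)
  have "(\<lambda>v. (a v, b v)) \<in> measurable (directions d) (restrict_space borel (Rd d \<times> Y))"
    using assms by (intro measurable_restrict_space2 borel_measurable_Pair) auto
  from measurable_compose[OF this f] show ?thesis .
qed

lemma borel_measurable_follower_comp:
  assumes "a \<in> borel_measurable (directions d)" "b \<in> borel_measurable (directions d)"
    and "\<And>v. v \<in> space (directions d) \<Longrightarrow> a v \<in> Rd d \<and> b v \<in> Y"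
  shows "(\<lambda>v. follower H k (b v) (a v)) \<in> borel_measurable (directions d)"
proof (induction k)
  case 0
  then show ?case using assms(2) by simp
next
  case (Suc k)
  have H: "(\<lambda>(y, x). H k y x) \<in> borel_measurable (restrict_space borel (Y \<times> Rd d))"
    using updates by (simp add: update_maps_def)
  have "(\<lambda>v. (follower H k (b v) (a v), a v)) \<in> measurable (directions d) (restrict_space borel (Y \<times> Rd d))"
    using assms Suc.IH follower_in_Y by (intro measurable_restrict_space2 borel_measurable_Pair) auto
  from measurable_compose[OF this H] show ?case by simp
qed

text \<open>The three components must be treated together, as each update uses the others.\<close>

lemma iter_measurable:
  "(\<lambda>v. X v t) \<in> borel_measurable (directions d) \<and> (\<lambda>v. init_hat v t) \<in> borel_measurable (directions d)
    \<and> (\<lambda>v. init_tilde v t) \<in> borel_measurable (directions d)"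
proof (induction t)
  case 0
  then show ?case by (simp add: iter_0)
next
  case (Suc t)
  have X: "(\<lambda>v. X v t) \<in> borel_measurable (directions d)"
    and y: "(\<lambda>v. init_hat v t) \<in> borel_measurable (directions d)" "(\<lambda>v. init_tilde v t) \<in> borel_measurable (directions d)"
    using Suc by auto
  have Xh: "(\<lambda>v. X_hat v t) \<in> borel_measurable (directions d)"
    unfolding X_hat_def
    by (intro borel_measurable_add borel_measurable_scaleR X borel_measurable_const borel_measurable_direction)
  have fo: "(\<lambda>v. follower H K (init_tilde v t) (X v t)) \<in> borel_measurable (directions d)"
    by (rule borel_measurable_follower_comp[OF X y(2)]) (use iter_in in blast)
  have foh: "(\<lambda>v. follower H K (init_hat v t) (X_hat v t)) \<in> borel_measurable (directions d)"
    by (rule borel_measurable_follower_comp[OF Xh y(1)]) (use iter_in X_hat_in in blast)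
  have "(\<lambda>v. slope v t) \<in> borel_measurable (directions d)"
    unfolding slope_def
    by (intro borel_measurable_times borel_measurable_diff borel_measurable_const
        borel_measurable_f_comp X Xh fo foh) (use iter_in X_hat_in follower_in_Y in blast)+
  then have "(\<lambda>v. X v (Suc t)) \<in> borel_measurable (directions d)"
    unfolding iter_Suc
    by (intro borel_measurable_diff borel_measurable_scaleR borel_measurable_times
        borel_measurable_const X borel_measurable_direction)
  then show ?case using fo by (simp add: iter_Suc)
qed

definition grad_iter :: "nat \<Rightarrow> (nat \<Rightarrow> rseq) \<Rightarrow> rseq" where
  "grad_iter t v = grad d F (X v t)"

lemma grad_iter_measurable: "grad_iter t \<in> borel_measurable (directions d)"
proof -
  have "continuous_on (Rd d) (grad d F)" using cond(6) by (rule lipschitz_on_continuous_on)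
  then have g: "grad d F \<in> borel_measurable (restrict_space borel (Rd d))"
    by (rule borel_measurable_continuous_on_restrict)
  have "(\<lambda>v. X v t) \<in> measurable (directions d) (restrict_space borel (Rd d))"
    using iter_measurable x_in_space by (intro measurable_restrict_space2) auto
  from measurable_compose[OF this g] show ?thesis unfolding grad_iter_def[abs_def] .
qed

text \<open>The iterate \<open>X\<^sub>t\<close> depends on the directions of earlier rounds only.\<close>

lemma X_indep: "X (v(t := x)) t = X v t"
  unfolding x_iter_def by (subst two_loop_cong[of t "v(t := x)" v]) auto

lemma expected_squared_projection:
  "integrable (directions d) (\<lambda>v. (norm (grad_iter t v))\<^sup>2)"
  "integrable (directions d) (\<lambda>v. (inner (grad_iter t v) (v t))\<^sup>2)"
  "(\<integral>v. (inner (grad_iter t v) (v t))\<^sup>2 \<partial>directions d) = (\<integral>v. (norm (grad_iter t v))\<^sup>2 \<partial>directions d) / real d"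
proof -
  have 1: "grad_iter t v \<in> Rd d" if "v \<in> space (directions d)" for v
    unfolding grad_iter_def by (rule grad_works(1)[OF cond(4) x_in_space[OF that]])
  have 2: "norm (grad_iter t v) \<le> Lt" if "v \<in> space (directions d)" for v
    unfolding grad_iter_def by (rule norm_grad_le_lipschitz[OF cond(4,5) x_in_space[OF that]])
  have 3: "grad_iter t (v(t := x)) = grad_iter t v" for v x
    unfolding grad_iter_def X_indep ..
  show "integrable (directions d) (\<lambda>v. (norm (grad_iter t v))\<^sup>2)"
    "integrable (directions d) (\<lambda>v. (inner (grad_iter t v) (v t))\<^sup>2)"
    "(\<integral>v. (inner (grad_iter t v) (v t))\<^sup>2 \<partial>directions d) = (\<integral>v. (norm (grad_iter t v))\<^sup>2 \<partial>directions d) / real d"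
    using expectation_squared_projection[OF d grad_iter_measurable 1 2 3] by blast+
qed

abbreviation E_grad :: "nat \<Rightarrow> real" where
  "E_grad t \<equiv> (\<integral>v. (norm (grad_iter t v))\<^sup>2 \<partial>directions d)"

text \<open>The descent inequality is summed path by path, so the objective telescopes before any
  integral is taken, and its final value is bounded below pointwise by the gap \<open>\<Delta>\<close>.\<close>

lemma sum_expected_gradients:
  assumes gap: "\<And>x. x \<in> Rd d \<Longrightarrow> F x0 - F x \<le> \<Delta>"
  shows "(\<Sum>t<T. \<eta> t * (E_grad t / 2)) \<le> \<Delta> + (\<Sum>t<T. etab * c_bias\<^sup>2 * \<beta>\<^sup>2 * (real d)\<^sup>2 * (decay t)\<^sup>2
    + c_noise * (decay t) ^ 4)"
proof -
  interpret D: prob_space "directions d" by (rule prob_space_directions[OF d])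
  let ?\<kappa> = "\<lambda>t. etab * c_bias\<^sup>2 * \<beta>\<^sup>2 * (real d)\<^sup>2 * (decay t)\<^sup>2 + c_noise * (decay t) ^ 4"
  let ?h = "\<lambda>t v. \<eta> t * (real d * (inner (grad_iter t v) (v t))\<^sup>2 - (norm (grad_iter t v))\<^sup>2 / 2)"
  have path: "(\<Sum>t<T. ?h t v) \<le> \<Delta> + (\<Sum>t<T. ?\<kappa> t)" if v: "v \<in> space (directions d)" for v
  proof -
    have "(\<Sum>t<T. ?h t v) \<le> (\<Sum>t<T. F (X v t) - F (X v (Suc t)) + ?\<kappa> t)"
      unfolding grad_iter_def by (intro sum_mono descent[OF v])
    also have "\<dots> = F x0 - F (X v T) + (\<Sum>t<T. ?\<kappa> t)"
      by (simp only: sum.distrib sum_lessThan_telescope'[of "\<lambda>t. F (X v t)"] iter_0)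
    finally show ?thesis using gap[OF x_in_space[OF v]] by (meson add_mono order_refl order_trans)
  qed
  have int: "integrable (directions d) (?h t)" for t
    by (intro integrable_mult_right Bochner_Integration.integrable_diff integrable_divide
        expected_squared_projection)
  have "(\<Sum>t<T. \<eta> t * (E_grad t / 2)) = (\<Sum>t<T. \<integral>v. ?h t v \<partial>directions d)"
  proof (intro sum.cong refl)
    fix t
    have "(\<integral>v. ?h t v \<partial>directions d) = \<eta> t * (\<integral>v. real d * (inner (grad_iter t v) (v t))\<^sup>2
        - (norm (grad_iter t v))\<^sup>2 / 2 \<partial>directions d)"
      by (rule integral_mult_right_zero)
    also have "(\<integral>v. real d * (inner (grad_iter t v) (v t))\<^sup>2 - (norm (grad_iter t v))\<^sup>2 / 2 \<partial>directions d) =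
        (\<integral>v. real d * (inner (grad_iter t v) (v t))\<^sup>2 \<partial>directions d)
        - (\<integral>v. (norm (grad_iter t v))\<^sup>2 / 2 \<partial>directions d)"
      by (intro Bochner_Integration.integral_diff integrable_mult_right integrable_divide
          expected_squared_projection)
    also have "(\<integral>v. real d * (inner (grad_iter t v) (v t))\<^sup>2 \<partial>directions d) = E_grad t"
      using d by (simp add: expected_squared_projection(3))
    also have "(\<integral>v. (norm (grad_iter t v))\<^sup>2 / 2 \<partial>directions d) = E_grad t / 2"
      by (rule integral_divide_zero)
    finally have eq: "(\<integral>v. ?h t v \<partial>directions d) = \<eta> t * (E_grad t - E_grad t / 2)" .
    show "\<eta> t * (E_grad t / 2) = (\<integral>v. ?h t v \<partial>directions d)" unfolding eq by simp
  qed
  also have "\<dots> = (\<integral>v. (\<Sum>t<T. ?h t v) \<partial>directions d)"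
    by (rule Bochner_Integration.integral_sum[symmetric]) (rule int)
  also have "\<dots> \<le> \<Delta> + (\<Sum>t<T. ?\<kappa> t)"
    by (rule D.integral_le_const) (auto intro: path int)
  finally show ?thesis .
qed

text \<open>Dividing by the sum of the step sizes.  The bias term is proportional to the same sum \<open>W\<close> and
  survives as a constant, while the remaining terms are divided by \<open>W\<close>, which is at least \<open>sqrt T\<close>.\<close>

lemma min_expected_gradient:
  assumes gap: "\<And>x. x \<in> Rd d \<Longrightarrow> F x0 - F x \<le> \<Delta>" and T: "T \<ge> 1"
    and m: "\<And>t. t < T \<Longrightarrow> m \<le> E_grad t"
  shows "m \<le> 2 * c_bias\<^sup>2 * \<beta>\<^sup>2 * (real d) ^ 3
    + 2 / etab * (\<Delta> + c_noise * (1 + ln (real T))) * (real d / sqrt (real T))"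
proof -
  define W where "W = (\<Sum>t<T. (decay t)\<^sup>2)"
  have \<Delta>: "0 \<le> \<Delta>" using gap[OF x0] by simp
  have noise: "0 \<le> c_noise" unfolding noise_const_def using etab const_nonneg by simp
  have W: "sqrt (real T) \<le> W"
  proof -
    have "sqrt (real T) = (\<Sum>t<T. 1 / sqrt (real T))" by (simp add: real_div_sqrt)
    also have "\<dots> \<le> W" unfolding W_def decay_power2
      by (intro sum_mono) (simp add: powr_minus_divide powr_half_sqrt frac_le)
    finally show ?thesis .
  qed
  have sT: "0 < sqrt (real T)" using T by simp
  then have W_pos: "0 < W" using W by linarith
  have "m * etab / (2 * real d) * W = (\<Sum>t<T. \<eta> t * (m / 2))"
    unfolding W_def \<eta>_eq sum_distrib_left by (intro sum.cong refl) (simp add: field_simps)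
  also have "\<dots> \<le> (\<Sum>t<T. \<eta> t * (E_grad t / 2))"
    using m \<eta>_pos by (intro sum_mono mult_left_mono) (auto simp: less_imp_le)
  also have "\<dots> \<le> \<Delta> + (\<Sum>t<T. etab * c_bias\<^sup>2 * \<beta>\<^sup>2 * (real d)\<^sup>2 * (decay t)\<^sup>2 + c_noise * (decay t) ^ 4)"
    by (rule sum_expected_gradients[OF gap])
  also have "\<dots> = \<Delta> + (etab * c_bias\<^sup>2 * \<beta>\<^sup>2 * (real d)\<^sup>2 * W + c_noise * (\<Sum>t<T. 1 / (real t + 1)))"
    by (simp only: W_def sum.distrib sum_distrib_left decay_power4)
  also have "\<dots> \<le> \<Delta> + (etab * c_bias\<^sup>2 * \<beta>\<^sup>2 * (real d)\<^sup>2 * W + c_noise * (1 + ln (real T)))"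
    by (intro add_mono mult_left_mono order_refl sum_inverse_le_ln T noise)
  finally have "m * etab / (2 * real d) * W \<le>
      etab * c_bias\<^sup>2 * \<beta>\<^sup>2 * (real d)\<^sup>2 * W + (\<Delta> + c_noise * (1 + ln (real T)))" by simp
  then have "m * etab / (2 * real d) * W * (2 * real d / (etab * W)) \<le>
      (etab * c_bias\<^sup>2 * \<beta>\<^sup>2 * (real d)\<^sup>2 * W + (\<Delta> + c_noise * (1 + ln (real T)))) * (2 * real d / (etab * W))"
    using etab W_pos by (intro mult_right_mono) auto
  then have "m \<le> 2 * c_bias\<^sup>2 * \<beta>\<^sup>2 * (real d) ^ 3
      + 2 / etab * (\<Delta> + c_noise * (1 + ln (real T))) * (real d / W)"
    using d etab W_pos by (simp add: field_simps power2_eq_square power3_eq_cube)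
  also have "\<dots> \<le> 2 * c_bias\<^sup>2 * \<beta>\<^sup>2 * (real d) ^ 3
      + 2 / etab * (\<Delta> + c_noise * (1 + ln (real T))) * (real d / sqrt (real T))"
    using \<Delta> noise etab T sT W W_pos
    by (intro add_mono mult_left_mono frac_le order_refl) (auto intro!: mult_nonneg_nonneg add_nonneg_nonneg)
  finally show ?thesis .
qed

end

section \<open>The convergence rate\<close>

text \<open>Both alternatives give a squared contraction factor proportional to \<open>\<alpha>\<close>.  In the exponential case
  it is even of order \<open>\<alpha>\<^sup>2\<close>, which is at most \<open>\<alpha>\<close>.  The constant \<open>1 + C\<^sup>2\<close> serves both alternatives.\<close>

lemma contraction_of_rates:
  fixes C lam \<rho> \<alpha> :: real
  assumes rate: "poly_rate d Y G H C lam \<and> \<alpha> = C * real K powr (- lam) \<or>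
      exp_rate d Y G H C \<rho> \<and> \<alpha> = \<rho> ^ K"
    and K: "K \<ge> 1" and xy: "x \<in> Rd d" "y \<in> Y"
  shows "0 \<le> \<alpha>"
    and "norm (follower H K y x - response Y G x) \<le> sqrt ((1 + C\<^sup>2) * \<alpha>) * norm (y - response Y G x)"
proof -
  let ?n = "norm (y - response Y G x)" and ?e = "norm (follower H K y x - response Y G x)"
  have "0 \<le> \<alpha> \<and> ?e\<^sup>2 \<le> (1 + C\<^sup>2) * \<alpha> * ?n\<^sup>2"
    using rate
  proof
    assume p: "poly_rate d Y G H C lam \<and> \<alpha> = C * real K powr (- lam)"
    then have "0 \<le> \<alpha>" "?e\<^sup>2 \<le> \<alpha> * ?n\<^sup>2"
      using K xy by (auto simp: poly_rate_def)
    moreover have "\<alpha> * ?n\<^sup>2 \<le> (1 + C\<^sup>2) * \<alpha> * ?n\<^sup>2"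
      using \<open>0 \<le> \<alpha>\<close> by (intro mult_right_mono) (auto simp: distrib_right)
    ultimately show ?thesis by linarith
  next
    assume e: "exp_rate d Y G H C \<rho> \<and> \<alpha> = \<rho> ^ K"
    then have "?e \<le> C * \<alpha> * ?n" and \<alpha>: "0 \<le> \<alpha>" "\<alpha> \<le> 1"
      using K xy by (auto simp: exp_rate_def power_le_one)
    then have "?e\<^sup>2 \<le> (C * \<alpha> * ?n)\<^sup>2" by (intro power_mono) auto
    also have "\<dots> = C\<^sup>2 * (\<alpha> * \<alpha>) * ?n\<^sup>2" by (simp add: power_mult_distrib power2_eq_square)
    also have "\<dots> \<le> (1 + C\<^sup>2) * (\<alpha> * 1) * ?n\<^sup>2"
      using \<alpha> by (intro mult_right_mono mult_mono mult_left_mono) auto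
    finally show ?thesis using \<alpha> by simp
  qed
  then have 0: "0 \<le> \<alpha>" and sq: "?e\<^sup>2 \<le> (1 + C\<^sup>2) * \<alpha> * ?n\<^sup>2" by auto
  show "0 \<le> \<alpha>" by (rule 0)
  show "?e \<le> sqrt ((1 + C\<^sup>2) * \<alpha>) * ?n"
  proof (rule power2_le_imp_le)
    show "?e\<^sup>2 \<le> (sqrt ((1 + C\<^sup>2) * \<alpha>) * ?n)\<^sup>2"
      using sq 0 by (simp add: power_mult_distrib)
  qed (use 0 in simp)
qed

theorem theorem1:
  fixes Lx Ly ly LS Lt lt Cs C lam \<rho> etab deltab D \<Delta> :: real
  assumes "etab > 0" and "deltab > 0" and "lt > 0"
  shows "\<exists>(A::real) (p::nat).
    \<forall>(d::nat) (Y :: (real ^ 'm) set) f G H (K::nat) (T::nat) x0 y0 yt0 (\<alpha>::real).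
      d \<ge> 1 \<longrightarrow> K \<ge> 1 \<longrightarrow> T \<ge> 1 \<longrightarrow>
      stackelberg_game d Y f G \<longrightarrow>
      update_maps d Y H \<longrightarrow>
      x0 \<in> Rd d \<longrightarrow> y0 \<in> Y \<longrightarrow> yt0 \<in> Y \<longrightarrow>
      lipschitz_smooth_conditions d Y f G Lx Ly ly LS Lt lt \<longrightarrow>
      stable_updates d Y H K Cs \<longrightarrow>
      (poly_rate d Y G H C lam \<and> \<alpha> = C * real K powr (- lam) \<or>
       exp_rate d Y G H C \<rho> \<and> \<alpha> = \<rho> ^ K) \<longrightarrow>
      \<alpha> < 1 \<longrightarrow>
      etab \<le> real d / (2 * lt) \<longrightarrow>
      diameter Y \<le> D \<longrightarrow>
      (\<forall>x\<in>Rd d. hyper_obj Y G f x0 - hyper_obj Y G f x \<le> \<Delta>) \<longrightarrow>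
      (MIN t\<in>{0..T}.
         prob_space.expectation (directions d)
           (\<lambda>v. (norm (grad d (hyper_obj Y G f)
              (x_iter d f H K (step_size etab d) (perturb_radius deltab d) x0 y0 yt0 v t)))\<^sup>2))
        \<le> A * (1 + ln (real T)) ^ p *
            (real d / sqrt (real T) + \<alpha> / (1 - \<alpha>) * real d ^ 3 * (1 + 1 / sqrt (real T)))"
proof -
  \<comment> \<open>\<open>a1\<close> multiplies the bias, \<open>a2\<close> the optimization error, and \<open>a3\<close> settles the case of large \<open>\<alpha> d\<^sup>3\<close>.
    Absolute values appear because \<open>\<Delta>\<close> and the noise constant are known to be nonnegative only
    once a game satisfying the hypotheses is given.\<close>
  define B where "B = 1 + C\<^sup>2"
  define a1 where "a1 = 2 * (bias_const Ly LS Lt etab deltab D)\<^sup>2 * B"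
  define a2 where "a2 = 2 / etab * (\<bar>\<Delta>\<bar> + \<bar>noise_const Ly LS Lt lt etab deltab D\<bar>)"
  define a3 where "a3 = Lt\<^sup>2 * (16 * B)"
  have B: "B \<ge> 1" by (simp add: B_def)
  have a: "0 \<le> a1" "0 \<le> a2" "0 \<le> a3"
    using assms B by (auto simp: a1_def a2_def a3_def)
  show ?thesis
  proof (intro exI[of _ "a1 + a2 + a3"] exI[of _ 1] allI impI)
    fix d :: nat and Y :: "(real ^ 'm) set" and f G H and K T :: nat and x0 y0 yt0 and \<alpha> :: real
    assume d: "d \<ge> 1" and K: "K \<ge> 1" and T: "T \<ge> 1"
      and game: "stackelberg_game d Y f G" and updates: "update_maps d Y H"
      and x0: "x0 \<in> Rd d" and y0: "y0 \<in> Y" and yt0: "yt0 \<in> Y"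
      and conditions: "lipschitz_smooth_conditions d Y f G Lx Ly ly LS Lt lt"
      and rate: "poly_rate d Y G H C lam \<and> \<alpha> = C * real K powr (- lam) \<or>
        exp_rate d Y G H C \<rho> \<and> \<alpha> = \<rho> ^ K"
      and \<alpha>1: "\<alpha> < 1" and diam: "diameter Y \<le> D"
      and gap: "\<forall>x\<in>Rd d. hyper_obj Y G f x0 - hyper_obj Y G f x \<le> \<Delta>"
    let ?E = "\<lambda>t. prob_space.expectation (directions d)
           (\<lambda>v. (norm (grad d (hyper_obj Y G f)
              (x_iter d f H K (step_size etab d) (perturb_radius deltab d) x0 y0 yt0 v t)))\<^sup>2)"
    define m where "m = (MIN t\<in>{0..T}. ?E t)"
    define L where "L = 1 + ln (real T)"
    define P where "P = real d / sqrt (real T)"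
    define Q where "Q = \<alpha> / (1 - \<alpha>) * real d ^ 3 * (1 + 1 / sqrt (real T))"
    have \<alpha>0: "0 \<le> \<alpha>" by (rule contraction_of_rates(1)[OF rate K x0 y0])
    have m_le: "m \<le> ?E t" if "t \<le> T" for t
      unfolding m_def using that by (intro Min_le) auto
    have L: "1 \<le> L" using T by (simp add: L_def)
    have P: "0 \<le> P" by (simp add: P_def)
    have Q: "\<alpha> * real d ^ 3 \<le> Q"
    proof -
      have "\<alpha> * 1 \<le> \<alpha> * (1 / (1 - \<alpha>))" using \<alpha>0 \<alpha>1 by (intro mult_left_mono) auto
      then have "\<alpha> * real d ^ 3 * 1 \<le> \<alpha> / (1 - \<alpha>) * real d ^ 3 * (1 + 1 / sqrt (real T))"
        using \<alpha>0 \<alpha>1 by (intro mult_mono mult_right_mono) auto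
      then show ?thesis by (simp add: Q_def)
    qed
    then have Q0: "0 \<le> Q" using \<alpha>0 by (meson mult_nonneg_nonneg of_nat_0_le_iff order_trans zero_le_power)
    have "m \<le> a1 * Q + a2 * L * P + a3 * Q"
    \<comment> \<open>The threshold makes \<open>\<beta>\<^sup>2 d\<^sup>3\<close> at most \<open>1 / 16\<close>, hence \<open>\<beta>\<close> at most \<open>1 / 4\<close>.\<close>
    proof (cases "\<alpha> * real d ^ 3 \<le> 1 / (16 * B)")
      case False
      interpret D: prob_space "directions d" by (rule prob_space_directions[OF d])
      have "m \<le> ?E 0" by (rule m_le) simp
      also have "\<dots> = (norm (grad d (hyper_obj Y G f) x0))\<^sup>2"
        by (simp add: x_iter_def D.prob_space)
      also have "\<dots> \<le> Lt\<^sup>2"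
        using conditions x0 unfolding lipschitz_smooth_conditions_def
        by (intro power_mono norm_grad_le_lipschitz) auto
      also have "\<dots> \<le> Lt\<^sup>2 * (16 * B * (\<alpha> * real d ^ 3))"
      proof -
        have "1 \<le> 16 * B * (\<alpha> * real d ^ 3)" using False B by (simp add: field_simps)
        from mult_left_mono[OF this zero_le_power2[of Lt]] show ?thesis by simp
      qed
      also have "\<dots> = a3 * (\<alpha> * real d ^ 3)" by (simp add: a3_def)
      also have "\<dots> \<le> a3 * Q" using Q a by (intro mult_left_mono)
      finally show ?thesis using a L P Q0 by (smt (verit) mult_nonneg_nonneg)
    next
      case True
      define \<beta> where "\<beta> = sqrt (B * \<alpha>)"
      have \<beta>2: "\<beta>\<^sup>2 = B * \<alpha>" using B \<alpha>0 by (simp add: \<beta>_def)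
      have small: "\<beta>\<^sup>2 * real d ^ 3 \<le> 1 / 16" using True B unfolding \<beta>2 by (simp add: field_simps)
      have d3: "1 \<le> real d ^ 3" using d by simp
      interpret two_loop_run d Y f G H K x0 y0 yt0 Lx Ly ly LS Lt lt etab deltab D \<beta>
      proof
        show "0 \<le> \<beta>" using B \<alpha>0 by (simp add: \<beta>_def)
        show "\<beta> \<le> 1 / 4"
        proof (rule power2_le_imp_le)
          have "\<beta>\<^sup>2 * 1 \<le> \<beta>\<^sup>2 * real d ^ 3" using d3 by (intro mult_left_mono) auto
          then show "\<beta>\<^sup>2 \<le> (1 / 4)\<^sup>2" using small by (simp add: power2_eq_square)
        qed simp
        show "\<beta> * (real d * sqrt (real d)) \<le> 1"
        proof (rule power2_le_imp_le)
          have "(\<beta> * (real d * sqrt (real d)))\<^sup>2 = \<beta>\<^sup>2 * real d ^ 3"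
            by (simp add: power_mult_distrib power3_eq_cube power2_eq_square[of "real d"])
          then show "(\<beta> * (real d * sqrt (real d)))\<^sup>2 \<le> 1\<^sup>2" using small by simp
        qed simp
        show "norm (follower H K y x - response Y G x) \<le> \<beta> * norm (y - response Y G x)"
          if "x \<in> Rd d" "y \<in> Y" for x y
          using contraction_of_rates(2)[OF rate K that] by (simp add: \<beta>_def B_def)
      qed (use assms d game updates x0 y0 yt0 conditions diam in auto)
      have "m \<le> 2 * c_bias\<^sup>2 * \<beta>\<^sup>2 * (real d) ^ 3
          + 2 / etab * (\<Delta> + c_noise * (1 + ln (real T))) * (real d / sqrt (real T))"
        using gap m_le by (intro min_expected_gradient T) (auto simp: grad_iter_def)
      also have "\<dots> = a1 * (\<alpha> * real d ^ 3) + 2 / etab * (\<Delta> + c_noise * L) * P"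
        by (simp add: \<beta>2 a1_def L_def P_def mult_ac)
      also have "\<dots> \<le> a1 * Q + a2 * L * P"
      proof (intro add_mono mult_left_mono mult_right_mono Q a P)
        have "\<Delta> + c_noise * L \<le> \<bar>\<Delta>\<bar> * L + \<bar>c_noise\<bar> * L"
          using L mult_left_mono[of 1 L "\<bar>\<Delta>\<bar>"] by (intro add_mono mult_right_mono) auto
        then have "2 / etab * (\<Delta> + c_noise * L) \<le> 2 / etab * ((\<bar>\<Delta>\<bar> + \<bar>c_noise\<bar>) * L)"
          using assms by (intro mult_left_mono) (auto simp: distrib_right)
        then show "2 / etab * (\<Delta> + c_noise * L) \<le> a2 * L" by (simp only: a2_def mult.assoc)
      qed
      finally show ?thesis using a Q0 by (smt (verit) mult_nonneg_nonneg)
    qed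
    also have "\<dots> \<le> a1 * (L * Q) + a2 * (L * P) + a3 * (L * Q)"
      using L Q0 a mult_right_mono[of 1 L Q] by (intro add_mono mult_left_mono) auto
    also have "\<dots> \<le> (a1 + a2 + a3) * L ^ 1 * (P + Q)"
    proof -
      have "0 \<le> a1 * (L * P) + a2 * (L * Q) + a3 * (L * P)"
        using a L P Q0 by (intro add_nonneg_nonneg mult_nonneg_nonneg) auto
      then show ?thesis by (simp add: algebra_simps)
    qed
    finally show "(MIN t\<in>{0..T}. ?E t) \<le> (a1 + a2 + a3) * (1 + ln (real T)) ^ 1 *
        (real d / sqrt (real T) + \<alpha> / (1 - \<alpha>) * real d ^ 3 * (1 + 1 / sqrt (real T)))"
      unfolding m_def L_def P_def Q_def .
  qed
qed

end
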